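(* Let $B=B(\Gamma,D,\gamma)$ be a simple twisted superalgebra of vector type over a field of characteristic $3$, and let $V$ be an irreducible faithful alternative $B$-superbimodule which is not associative. Then, up to change of parity of $V$, the following holds: $(V_{\bar0},d)$ is a $D$-simple faithful associative and commutative bimodule over the algebra with derivation $(\Gamma,D)$, where $d(v)=-(v,\bar1,\bar1)$ is a derivation of $V_{\bar0}$; $V_{\bar1}=V_{\bar0}\cdot\bar1$ is an isomorphic copy of $V_{\bar0}$; and $V\cong B(V_{\bar0},d,\gamma)$.
   Context: A superalgebra is a $\mathbb Z_2$-graded algebra $A=A_{\bar0}\oplus A_{\bar1}$; $(x,y,z)=(xy)z-x(yz)$. $A$ is alternative if for $a\in A_i,b\in A_j,c\in A_k$ one has $(a,b,c)=(-1)^{jk+1}(a,c,b)$, $(a,b,c)=(-1)^{ij+1}(b,a,c)$, and $(a,a,c)=0$ for $a\in A_{\bar0}$, $c\in A$. A superbimodule $V=V_{\bar0}\oplus V_{\bar1}$ is alternative if the split null extension $E=A\oplus V$ (with $V^2=0$) is an alternative superalgebra. Irreducible: $V\ne0$ with no graded subbimodules except $0,V$. Faithful: $\{a: a\cdot V=V\cdot a=0\}=0$. Associative: $(V,A,A)=0$. Change of parity: $V$ is replaced by $V^{\mathrm{op}}$, the same space with even and odd parts interchanged, left action $(-1)^{|a|}a\cdot v$ and the same right action. $B(\Gamma,D,\gamma)$: $\Gamma$ is an associative commutative algebra with $1$ over a field $F$ of characteristic $3$, $D$ a nonzero derivation of $\Gamma$, $\gamma\in\Gamma$, $\bar\Gamma$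 a copy of the space $\Gamma$ via $a\mapsto\bar a$; $B(\Gamma,D,\gamma)=\Gamma\oplus\bar\Gamma$ has even part $\Gamma$, odd part $\bar\Gamma$ and product $a\cdot b=ab$, $a\cdot\bar b=\bar a\cdot b=\overline{ab}$, $\bar a\cdot\bar b=\gamma ab+2D(a)b+aD(b)$. It is simple if and only if $\Gamma$ is $D$-simple (has no proper nonzero $D$-invariant ideals). A bimodule with derivation (or $D$-bimodule) $(W,d)$ over $(\Gamma,D)$ is a $\Gamma$-bimodule $W$ with a linear map $d:W\to W$ such that $a+v\mapsto D(a)+d(v)$ is a derivation of the split null extension $\Gamma\oplus W$; $(W,d)$ is $D$-simple if $W$ has no proper nonzero $d$-invariant $\Gamma$-subbimodules; it is associative and commutative if $\Gamma\oplus W$ is. For such an associative commutative $(W,d)$, the $B(\Gamma,D,\gamma)$-superbimodule $B(W,d,\gamma)=W\oplus\bar W$ (even part $W$, odd part a copy $\bar W$) has the action $a\cdot v=v\cdot a=av$, $\bar a\cdot v=v\cdot\bar a=a\cdot\bar v=\bar v\cdot a=\overline{av}$, $\bar a\cdot\bar v=2D(a)v+ad(v)+\gamma av$, $\bar v\cdot\bar a=2d(v)a+vD(a)+\gamma va$ for $a\in\Gamma$, $v\in W$. *)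

theory Defs
  imports Complex_Main "HOL-Library.Z2" "HOL-Library.Product_Plus"
begin

section \<open>Linear maps on subspaces\<close>

definition linear_on ::
  "'v set \<Rightarrow> ('f::field \<Rightarrow> 'v::ab_group_add \<Rightarrow> 'v) \<Rightarrow> ('f \<Rightarrow> 'w::ab_group_add \<Rightarrow> 'w) \<Rightarrow> ('v \<Rightarrow> 'w) \<Rightarrow> bool"
  where "linear_on U s t f \<longleftrightarrow>
    (\<forall>x\<in>U. \<forall>y\<in>U. f (x + y) = f x + f y) \<and> (\<forall>c. \<forall>x\<in>U. f (s c x) = t c (f x))"

definition bilinear_on ::
  "'u set \<Rightarrow> 'v set \<Rightarrow> ('f::field \<Rightarrow> 'u::ab_group_add \<Rightarrow> 'u) \<Rightarrow> ('f \<Rightarrow> 'v::ab_group_add \<Rightarrow> 'v) \<Rightarrow>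
    ('f \<Rightarrow> 'w::ab_group_add \<Rightarrow> 'w) \<Rightarrow> ('u \<Rightarrow> 'v \<Rightarrow> 'w) \<Rightarrow> bool"
  where "bilinear_on U V s t u f \<longleftrightarrow>
    (\<forall>x\<in>U. linear_on V t u (f x)) \<and> (\<forall>y\<in>V. linear_on U s u (\<lambda>x. f x y))"


section \<open>Superspaces, superalgebras and superbimodules\<close>

text \<open>Gradings are indexed by the field \<^typ>\<open>bit\<close> of integers mod 2. A superspace is the direct sum
  of its two parts, which are subspaces of an ambient vector space (the whole type).\<close>

record ('f, 'v) sspace =
  scl :: "'f \<Rightarrow> 'v \<Rightarrow> 'v"
  part :: "bit \<Rightarrow> 'v set"

record ('f, 'a) salgebra = "('f, 'a) sspace" +
  mul :: "'a \<Rightarrow> 'a \<Rightarrow> 'a"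

record ('f, 'a, 'v) sbimodule = "('f, 'v) sspace" +
  lact :: "'a \<Rightarrow> 'v \<Rightarrow> 'v"
  ract :: "'v \<Rightarrow> 'a \<Rightarrow> 'v"

definition total :: "('f::field, 'v::ab_group_add, 'x) sspace_scheme \<Rightarrow> 'v set"
  where "total V = {x + y | x y. x \<in> part V 0 \<and> y \<in> part V 1}"

definition superspace :: "('f::field, 'v::ab_group_add, 'x) sspace_scheme \<Rightarrow> bool"
  where "superspace V \<longleftrightarrow> vector_space (scl V) \<and> (\<forall>i. module.subspace (scl V) (part V i)) \<and>
    part V 0 \<inter> part V 1 = {0}"

definition component :: "('f::field, 'v::ab_group_add, 'x) sspace_scheme \<Rightarrow> bit \<Rightarrow> 'v \<Rightarrow> 'v"
  where "component V i x = (THE y. y \<in> part V i \<and> x - y \<in> part V (i + 1))"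

definition graded_subspace :: "('f::field, 'v::ab_group_add, 'x) sspace_scheme \<Rightarrow> 'v set \<Rightarrow> bool"
  where "graded_subspace V S \<longleftrightarrow> module.subspace (scl V) S \<and>
    S = {x + y | x y. x \<in> S \<inter> part V 0 \<and> y \<in> S \<inter> part V 1}"

definition superalgebra :: "('f::field, 'a::ab_group_add) salgebra \<Rightarrow> bool"
  where "superalgebra A \<longleftrightarrow> superspace A \<and>
    bilinear_on (total A) (total A) (scl A) (scl A) (scl A) (mul A) \<and>
    (\<forall>i j. \<forall>a\<in>part A i. \<forall>b\<in>part A j. mul A a b \<in> part A (i + j))"

definition associator :: "('f::field, 'a::ab_group_add) salgebra \<Rightarrow> 'a \<Rightarrow> 'a \<Rightarrow> 'a \<Rightarrow> 'a"
  where "associator A x y z = mul A (mul A x y) z - mul A x (mul A y z)"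

definition alternative_superalgebra :: "('f::field, 'a::ab_group_add) salgebra \<Rightarrow> bool"
  where "alternative_superalgebra A \<longleftrightarrow> superalgebra A \<and>
    (\<forall>i j k. \<forall>a\<in>part A i. \<forall>b\<in>part A j. \<forall>c\<in>part A k.
       associator A a b c = scl A ((- 1) ^ (of_bit (j * k) + 1)) (associator A a c b) \<and>
       associator A a b c = scl A ((- 1) ^ (of_bit (i * j) + 1)) (associator A b a c)) \<and>
    (\<forall>a\<in>part A 0. \<forall>c\<in>total A. associator A a a c = 0)"

definition graded_ideal :: "('f::field, 'a::ab_group_add) salgebra \<Rightarrow> 'a set \<Rightarrow> bool"
  where "graded_ideal A I \<longleftrightarrow> graded_subspace A I \<and>
    (\<forall>a\<in>total A. \<forall>x\<in>I. mul A a x \<in> I \<and> mul A x a \<in> I)"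

definition simple_superalgebra :: "('f::field, 'a::ab_group_add) salgebra \<Rightarrow> bool"
  where "simple_superalgebra A \<longleftrightarrow> superalgebra A \<and>
    (\<exists>a\<in>total A. \<exists>b\<in>total A. mul A a b \<noteq> 0) \<and>
    (\<forall>I. graded_ideal A I \<longrightarrow> I = {0} \<or> I = total A)"

definition superbimodule ::
  "('f::field, 'a::ab_group_add) salgebra \<Rightarrow> ('f, 'a, 'v::ab_group_add) sbimodule \<Rightarrow> bool"
  where "superbimodule A V \<longleftrightarrow> superspace V \<and>
    bilinear_on (total A) (total V) (scl A) (scl V) (scl V) (lact V) \<and>
    bilinear_on (total V) (total A) (scl V) (scl A) (scl V) (ract V) \<and>
    (\<forall>i j. \<forall>a\<in>part A i. \<forall>v\<in>part V j.
       lact V a v \<in> part V (i + j) \<and> ract V v a \<in> part V (j + i))"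

definition split_null_extension ::
  "('f::field, 'a::ab_group_add) salgebra \<Rightarrow> ('f, 'a, 'v::ab_group_add) sbimodule \<Rightarrow>
    ('f, 'a \<times> 'v) salgebra"
  where "split_null_extension A V =
    \<lparr> scl = (\<lambda>c (a, v). (scl A c a, scl V c v)),
      part = (\<lambda>i. part A i \<times> part V i),
      mul = (\<lambda>(a, v) (b, w). (mul A a b, lact V a w + ract V v b)) \<rparr>"

definition alternative_superbimodule ::
  "('f::field, 'a::ab_group_add) salgebra \<Rightarrow> ('f, 'a, 'v::ab_group_add) sbimodule \<Rightarrow> bool"
  where "alternative_superbimodule A V \<longleftrightarrow>
    superbimodule A V \<and> alternative_superalgebra (split_null_extension A V)"

definition graded_subbimodule ::
  "('f::field, 'a::ab_group_add) salgebra \<Rightarrow> ('f, 'a, 'v::ab_group_add) sbimodule \<Rightarrow> 'v set \<Rightarrow> bool"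
  where "graded_subbimodule A V S \<longleftrightarrow> graded_subspace V S \<and>
    (\<forall>a\<in>total A. \<forall>v\<in>S. lact V a v \<in> S \<and> ract V v a \<in> S)"

definition irreducible_superbimodule ::
  "('f::field, 'a::ab_group_add) salgebra \<Rightarrow> ('f, 'a, 'v::ab_group_add) sbimodule \<Rightarrow> bool"
  where "irreducible_superbimodule A V \<longleftrightarrow> total V \<noteq> {0} \<and>
    (\<forall>S. graded_subbimodule A V S \<longrightarrow> S = {0} \<or> S = total V)"

definition faithful_superbimodule ::
  "('f::field, 'a::ab_group_add) salgebra \<Rightarrow> ('f, 'a, 'v::ab_group_add) sbimodule \<Rightarrow> bool"
  where "faithful_superbimodule A V \<longleftrightarrow>
    {a \<in> total A. \<forall>v\<in>total V. lact V a v = 0 \<and> ract V v a = 0} = {0}"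

text \<open>The associator \<open>(v, a, b)\<close> in the split null extension, for \<open>v\<close> in the bimodule.\<close>

definition right_associator ::
  "('f::field, 'a::ab_group_add) salgebra \<Rightarrow> ('f, 'a, 'v::ab_group_add) sbimodule \<Rightarrow>
    'v \<Rightarrow> 'a \<Rightarrow> 'a \<Rightarrow> 'v"
  where "right_associator A V v a b = ract V (ract V v a) b - ract V v (mul A a b)"

definition associative_superbimodule ::
  "('f::field, 'a::ab_group_add) salgebra \<Rightarrow> ('f, 'a, 'v::ab_group_add) sbimodule \<Rightarrow> bool"
  where "associative_superbimodule A V \<longleftrightarrow>
    (\<forall>v\<in>total V. \<forall>a\<in>total A. \<forall>b\<in>total A. right_associator A V v a b = 0)"

text \<open>The new left action is \<open>(-1)\<^bsup>|a|\<^esup> a \<cdot> v\<close>, extended additively to inhomogeneous \<open>a\<close>.\<close>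

definition change_parity ::
  "('f::field, 'a::ab_group_add) salgebra \<Rightarrow> ('f, 'a, 'v::ab_group_add) sbimodule \<Rightarrow>
    ('f, 'a, 'v) sbimodule"
  where "change_parity A V = V
    \<lparr> part := (\<lambda>i. part V (i + 1)),
      lact := (\<lambda>a v. lact V (component A 0 a) v - lact V (component A 1 a) v) \<rparr>"

definition isomorphic_superbimodules ::
  "('f::field, 'a::ab_group_add) salgebra \<Rightarrow> ('f, 'a, 'v::ab_group_add) sbimodule \<Rightarrow>
    ('f, 'a, 'w::ab_group_add) sbimodule \<Rightarrow> bool"
  where "isomorphic_superbimodules A V W \<longleftrightarrow> (\<exists>\<phi>.
    linear_on (total V) (scl V) (scl W) \<phi> \<and> bij_betw \<phi> (total V) (total W) \<and>
    (\<forall>i. \<phi> ` part V i \<subseteq> part W i) \<and>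
    (\<forall>a\<in>total A. \<forall>v\<in>total V.
       \<phi> (lact V a v) = lact W a (\<phi> v) \<and> \<phi> (ract V v a) = ract W (\<phi> v) a))"


section \<open>Algebras with derivation and their bimodules\<close>

definition comm_algebra :: "('f::field \<Rightarrow> 'g::comm_ring_1 \<Rightarrow> 'g) \<Rightarrow> bool"
  where "comm_algebra s \<longleftrightarrow> vector_space s \<and> (\<forall>c a b. s c (a * b) = s c a * b)"

definition derivation_on ::
  "'e set \<Rightarrow> ('f::field \<Rightarrow> 'e::ab_group_add \<Rightarrow> 'e) \<Rightarrow> ('e \<Rightarrow> 'e \<Rightarrow> 'e) \<Rightarrow> ('e \<Rightarrow> 'e) \<Rightarrow> bool"
  where "derivation_on E s m D \<longleftrightarrow> linear_on E s s D \<and> D ` E \<subseteq> E \<and>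
    (\<forall>x\<in>E. \<forall>y\<in>E. D (m x y) = m (D x) y + m x (D y))"

text \<open>Bimodules over a commutative algebra \<open>\<Gamma>\<close>, which is a whole type; the carrier of the bimodule
  is a subspace of an ambient vector space.\<close>

record ('f, 'g, 'v) bimodule =
  bscl :: "'f \<Rightarrow> 'v \<Rightarrow> 'v"
  bcarrier :: "'v set"
  bleft :: "'g \<Rightarrow> 'v \<Rightarrow> 'v"
  bright :: "'v \<Rightarrow> 'g \<Rightarrow> 'v"

definition is_bimodule ::
  "('f::field \<Rightarrow> 'g::comm_ring_1 \<Rightarrow> 'g) \<Rightarrow> ('f, 'g, 'v::ab_group_add) bimodule \<Rightarrow> bool"
  where "is_bimodule s W \<longleftrightarrow> vector_space (bscl W) \<and> module.subspace (bscl W) (bcarrier W) \<and>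
    bilinear_on UNIV (bcarrier W) s (bscl W) (bscl W) (bleft W) \<and>
    bilinear_on (bcarrier W) UNIV (bscl W) s (bscl W) (bright W) \<and>
    (\<forall>a. \<forall>v\<in>bcarrier W. bleft W a v \<in> bcarrier W \<and> bright W v a \<in> bcarrier W)"

definition ext_carrier :: "('f::field, 'g::comm_ring_1, 'v::ab_group_add) bimodule \<Rightarrow> ('g \<times> 'v) set"
  where "ext_carrier W = UNIV \<times> bcarrier W"

definition ext_scl ::
  "('f::field \<Rightarrow> 'g::comm_ring_1 \<Rightarrow> 'g) \<Rightarrow> ('f, 'g, 'v::ab_group_add) bimodule \<Rightarrow>
    'f \<Rightarrow> 'g \<times> 'v \<Rightarrow> 'g \<times> 'v"
  where "ext_scl s W = (\<lambda>c (a, v). (s c a, bscl W c v))"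

definition ext_mul ::
  "('f::field, 'g::comm_ring_1, 'v::ab_group_add) bimodule \<Rightarrow> 'g \<times> 'v \<Rightarrow> 'g \<times> 'v \<Rightarrow> 'g \<times> 'v"
  where "ext_mul W = (\<lambda>(a, v) (b, w). (a * b, bleft W a w + bright W v b))"

definition assoc_comm_bimodule :: "('f::field, 'g::comm_ring_1, 'v::ab_group_add) bimodule \<Rightarrow> bool"
  where "assoc_comm_bimodule W \<longleftrightarrow>
    (\<forall>x\<in>ext_carrier W. \<forall>y\<in>ext_carrier W. \<forall>z\<in>ext_carrier W.
       ext_mul W (ext_mul W x y) z = ext_mul W x (ext_mul W y z)) \<and>
    (\<forall>x\<in>ext_carrier W. \<forall>y\<in>ext_carrier W. ext_mul W x y = ext_mul W y x)"

definition D_bimodule ::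
  "('f::field \<Rightarrow> 'g::comm_ring_1 \<Rightarrow> 'g) \<Rightarrow> ('g \<Rightarrow> 'g) \<Rightarrow>
    ('f, 'g, 'v::ab_group_add) bimodule \<Rightarrow> ('v \<Rightarrow> 'v) \<Rightarrow> bool"
  where "D_bimodule s D W d \<longleftrightarrow> is_bimodule s W \<and>
    linear_on (bcarrier W) (bscl W) (bscl W) d \<and> d ` bcarrier W \<subseteq> bcarrier W \<and>
    derivation_on (ext_carrier W) (ext_scl s W) (ext_mul W) (\<lambda>(a, v). (D a, d v))"

definition D_simple_bimodule ::
  "('f::field, 'g::comm_ring_1, 'v::ab_group_add) bimodule \<Rightarrow> ('v \<Rightarrow> 'v) \<Rightarrow> bool"
  where "D_simple_bimodule W d \<longleftrightarrow>
    (\<forall>S. module.subspace (bscl W) S \<and> S \<subseteq> bcarrier W \<and>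
       (\<forall>a. \<forall>v\<in>S. bleft W a v \<in> S \<and> bright W v a \<in> S) \<and> d ` S \<subseteq> S
       \<longrightarrow> S = {0} \<or> S = bcarrier W)"

definition faithful_bimodule :: "('f::field, 'g::comm_ring_1, 'v::ab_group_add) bimodule \<Rightarrow> bool"
  where "faithful_bimodule W \<longleftrightarrow>
    {a. \<forall>v\<in>bcarrier W. bleft W a v = 0 \<and> bright W v a = 0} = {0}"

definition bimodule_iso ::
  "('f::field, 'g::comm_ring_1, 'v::ab_group_add) bimodule \<Rightarrow>
    ('f, 'g, 'w::ab_group_add) bimodule \<Rightarrow> ('v \<Rightarrow> 'w) \<Rightarrow> bool"
  where "bimodule_iso W W' f \<longleftrightarrow>
    linear_on (bcarrier W) (bscl W) (bscl W') f \<and> bij_betw f (bcarrier W) (bcarrier W') \<and>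
    (\<forall>a. \<forall>v\<in>bcarrier W. f (bleft W a v) = bleft W' a (f v) \<and> f (bright W v a) = bright W' (f v) a)"


section \<open>Twisted superalgebras of vector type\<close>

text \<open>The pair \<open>(a, b)\<close> stands for \<open>a\<close> plus the odd copy of \<open>b\<close>.\<close>

abbreviation bar :: "'g::zero \<Rightarrow> 'g \<times> 'g"
  where "bar b \<equiv> (0, b)"

definition vector_type ::
  "('f::field \<Rightarrow> 'g::comm_ring_1 \<Rightarrow> 'g) \<Rightarrow> ('g \<Rightarrow> 'g) \<Rightarrow> 'g \<Rightarrow> ('f, 'g \<times> 'g) salgebra"
  where "vector_type s D \<gamma> =
    \<lparr> scl = (\<lambda>c (a, b). (s c a, s c b)),
      part = (\<lambda>i. if i = 0 then UNIV \<times> {0} else {0} \<times> UNIV),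
      mul = (\<lambda>(a, b) (a', b').
        (a * a' + (\<gamma> * b * b' + 2 * D b * b' + b * D b'), a * b' + b * a')) \<rparr>"

definition vector_type_bimodule ::
  "('g \<Rightarrow> 'g) \<Rightarrow> 'g \<Rightarrow> ('f::field, 'g::comm_ring_1, 'v::ab_group_add) bimodule \<Rightarrow> ('v \<Rightarrow> 'v) \<Rightarrow>
    ('f, 'g \<times> 'g, 'v \<times> 'v) sbimodule"
  where "vector_type_bimodule D \<gamma> W d =
    \<lparr> scl = (\<lambda>c (v, w). (bscl W c v, bscl W c w)),
      part = (\<lambda>i. if i = 0 then bcarrier W \<times> {0} else {0} \<times> bcarrier W),
      lact = (\<lambda>(a, b) (v, w).
        (bleft W a v + (bleft W (2 * D b) w + bleft W b (d w) + bleft W (\<gamma> * b) w),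
         bleft W a w + bleft W b v)),
      ract = (\<lambda>(v, w) (a, b).
        (bleft W a v + (bscl W 2 (bright W (d w) b) + bright W w (D b) + bleft W \<gamma> (bright W w b)),
         bleft W a w + bleft W b v)) \<rparr>"

text \<open>A homogeneous part of a superbimodule over \<^const>\<open>vector_type\<close>, as a bimodule over the even
  part \<open>\<Gamma>\<close>.\<close>

definition part_bimodule ::
  "('f::field, 'g::comm_ring_1 \<times> 'g, 'v::ab_group_add) sbimodule \<Rightarrow> bit \<Rightarrow> ('f, 'g, 'v) bimodule"
  where "part_bimodule V i =
    \<lparr> bscl = scl V, bcarrier = part V i,
      bleft = (\<lambda>a v. lact V (a, 0) v), bright = (\<lambda>v a. ract V v (a, 0)) \<rparr>"

end

theory Submission
  imports Defs
begin

text \<open>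
  Write \<open>x\<close> for the odd element \<open>bar 1\<close>, so that \<open>bar b = b x\<close>, and read every element of
  \<open>B\<close> as a left and as a right multiplication operator on \<open>V\<close>. The alternative laws for
  triples with one entry in \<open>V\<close> become identities between these operators, in which
  \<open>1/2 = -1\<close>.

  The laws first force \<open>V\<close> to be unital: the unit of \<open>B\<close> acts by idempotents that commute
  with all multiplications, and neither the left nor the right action can vanish. Next, the
  difference \<open>\<phi> a\<close> of the left and the right multiplication by an even \<open>a\<close> commutes with all
  multiplications, because the defect is a sum of three equal associators. By Schur's lemma
  \<open>\<phi> a\<close> is zero or bijective, and in the second case \<open>D a\<close> annihilates \<open>V\<close>; as \<open>D\<close> is not
  zero, linearity in \<open>a\<close> gives \<open>\<phi> = 0\<close>. The commutator of two even multiplications is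
  central in the same sense and is killed by Schur's lemma too. So \<open>V\<close> is an associative and
  commutative \<open>\<Gamma>\<close>-module.

  Let \<open>X\<close> be right multiplication by \<open>x\<close> and \<open>T a = a X - X a\<close>. Then \<open>T\<close> is a derivation in
  \<open>a\<close>, \<open>T a\<close> commutes with \<open>\<Gamma>\<close>, and \<open>T a X + X T a = D a\<close>. Left multiplication by \<open>x\<close> is
  recovered from \<open>\<Gamma>\<close>, \<open>X\<close> and the parity operator, because \<open>D\<close>-simplicity puts \<open>1\<close> into the
  ideal generated by the image of \<open>D\<close>; so subbimodules are the graded subspaces stable under
  \<open>\<Gamma>\<close> and \<open>X\<close> (\<open>irreducible_l_X\<close>). Since \<open>T a T b + T b T a\<close> commutes with \<open>X\<close>, Schur's
  lemma makes the \<open>T a\<close> anticommute. The picture to keep in mind is that of the differential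
  forms of \<open>\<Gamma>\<close>: up to signs, \<open>T a\<close> is multiplication by the form \<open>da\<close> and \<open>X\<close> is the
  exterior derivative plus the contraction with \<open>D\<close>. These operators satisfy the relations
  above, and there the forms of degree at least two generate a proper submodule.

  The heart of the proof is that forms of degree two act as zero (\<open>TT_zero\<close>). If \<open>n w \<noteq> 0\<close>
  for \<open>n = T a T b\<close>, then \<open>w\<close> is a combination of terms \<open>X^i n w\<close> with \<open>i\<close> bounded. Moving
  \<open>X\<close> to the right differentiates the forms, at most once for each \<open>X\<close>. Iterating the
  relation, the number of form factors and the number of derivatives both grow linearly, so
  arbitrarily many factors come from a fixed finite set of operators \<open>T c\<close>; but these
  anticommute and have square zero. The argument is organised as a Nakayama lemma for this
  finite set.

  Once all \<open>T a T b\<close> vanish, the vectors of some parity killed by every \<open>T a\<close> are not all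
  zero. Together with their images under \<open>X\<close> they form a subbimodule, hence all of \<open>V\<close>. This
  picks out the part of \<open>V\<close> that becomes the even part, and all products are then determined
  by \<open>\<Gamma>\<close>, \<open>D\<close>, \<open>\<gamma>\<close> and \<open>d = \<gamma> - X^2\<close>, as in the model.
\<close>

section \<open>Alternative actions of \<open>B(\<Gamma>, D, \<gamma>)\<close> in characteristic 3\<close>

text \<open>
  The operators \<open>l a\<close>, \<open>r a\<close> stand for left and right multiplication by the even \<open>a\<close>, and
  \<open>L b\<close>, \<open>R b\<close> for those by \<open>bar b\<close>; \<open>par\<close> is the sign operator of the grading. All of them
  are taken on the whole type, composed with a projection onto the carrier \<open>M\<close>, which makes
  the identities unconditional. The scalar \<open>c\<close> acts as \<open>sc c\<close>, and \<open>em c\<close> is the element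
  \<open>c 1\<close> of \<open>\<Gamma>\<close>.

  The laws are named by the position of the vector in the associators that they equate:
  \<open>left\<close> for \<open>(a, b, v)\<close>, \<open>middle\<close> for \<open>(a, v, b)\<close> and \<open>right\<close> for \<open>(v, a, b)\<close>; \<open>skew\<close> and
  \<open>sym\<close> exchange \<open>a\<close> and \<open>b\<close>. The suffixes tell the parities of \<open>a\<close> and \<open>b\<close>. Exchanging a
  vector with an odd element costs a sign that depends on the parity of the vector; this is
  where \<open>par\<close> enters.
\<close>

locale alternative_action =
  fixes D :: "'g::comm_ring_1 \<Rightarrow> 'g" and \<gamma> :: 'g
    and M :: "'v::ab_group_add set"
    and l r L R :: "'g \<Rightarrow> 'v \<Rightarrow> 'v" and par :: "'v \<Rightarrow> 'v"
    and sc :: "'k \<Rightarrow> 'v \<Rightarrow> 'v" and em :: "'k \<Rightarrow> 'g"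
  assumes D_add: "D (a + b) = D a + D b"
    and D_mult: "D (a * b) = D a * b + a * D b"
    and D_nonzero: "\<exists>a. D a \<noteq> 0"
    and D_simple: "\<lbrakk>0 \<in> I; \<And>x y. x \<in> I \<Longrightarrow> y \<in> I \<Longrightarrow> x + y \<in> I; \<And>a x. x \<in> I \<Longrightarrow> a * x \<in> I;
      \<And>x. x \<in> I \<Longrightarrow> D x \<in> I\<rbrakk> \<Longrightarrow> I = {0} \<or> I = UNIV"
    and three: "v + v + v = (0::'v)"
    and M_add: "u \<in> M \<Longrightarrow> v \<in> M \<Longrightarrow> u + v \<in> M"
    and M_ops: "l a v \<in> M" "r a v \<in> M" "L a v \<in> M" "R a v \<in> M" "par v \<in> M"
    and M_nonzero: "\<exists>v\<in>M. v \<noteq> 0"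
    and op_add: "l a (u + v) = l a u + l a v" "r a (u + v) = r a u + r a v"
      "L a (u + v) = L a u + L a v" "R a (u + v) = R a u + R a v" "par (u + v) = par u + par v"
    and arg_add: "l (a + b) v = l a v + l b v" "r (a + b) v = r a v + r b v"
      "L (a + b) v = L a v + L b v" "R (a + b) v = R a v + R b v"
    and par_op: "par (l a v) = l a (par v)" "par (r a v) = r a (par v)"
      "par (L a v) = - L a (par v)" "par (R a v) = - R a (par v)"
    and par_par: "v \<in> M \<Longrightarrow> par (par v) = v"
    and op_par_par: "L a (par (par v)) = L a v" "R a (par (par v)) = R a v" "l a (par (par v)) = l a v"
    and left_skew_ee: "l (a * b) v - l a (l b v) = - (l (a * b) v - l b (l a v))"
    and right_skew_ee: "r b (r a v) - r (a * b) v = - (r a (r b v) - r (a * b) v)"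
    and left_middle_ee: "l (a * b) v - l a (l b v) = - (r b (l a v) - l a (r b v))"
    and middle_right_ee: "r b (l a v) - l a (r b v) = - (r b (r a v) - r (a * b) v)"
    and left_skew_eo: "L (a * b) v - l a (L b v) = - (L (a * b) v - L b (l a v))"
    and right_skew_eo: "R b (r a v) - R (a * b) v = - (r a (R b v) - R (a * b) v)"
    and middle_right_eo: "R b (l a v) - l a (R b v) = - (R b (r a v) - R (a * b) v)"
    and middle_left_eo: "r a (L b v) - L b (r a v) = - (L (a * b) v - L b (l a v))"
    and left_middle_eo: "L (a * b) v - l a (L b v) = - (R b (l a (par v)) - l a (R b (par v)))"
    and right_sym_oo: "R c (R b v) - r (\<gamma> * b * c + 2 * D b * c + b * D c) v =
              R b (R c v) - r (\<gamma> * c * b + 2 * D c * b + c * D b) v"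
    and left_sym_oo: "l (\<gamma> * b * c + 2 * D b * c + b * D c) v - L b (L c v) =
              l (\<gamma> * c * b + 2 * D c * b + c * D b) v - L c (L b v)"
    and right_middle_oo: "R c (R b v) - r (\<gamma> * b * c + 2 * D b * c + b * D c) v =
              - (R c (L b (par v)) - L b (R c (par v)))"
    and middle_left_oo: "R c (L b (par v)) - L b (R c (par v)) =
              - (l (\<gamma> * b * c + 2 * D b * c + b * D c) v - L b (L c v))"
    and sc_M: "v \<in> M \<Longrightarrow> sc k v \<in> M"
    and sc_op: "l a (sc k v) = sc k (l a v)" "r a (sc k v) = sc k (r a v)" "sc k 0 = 0"
    and sc_em: "sc k (l a v) = l (em k * a) v"
    and irreducible: "\<lbrakk>S \<subseteq> M; 0 \<in> S; \<And>u v. u \<in> S \<Longrightarrow> v \<in> S \<Longrightarrow> u + v \<in> S;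
      \<And>a v. v \<in> S \<Longrightarrow> l a v \<in> S; \<And>a v. v \<in> S \<Longrightarrow> r a v \<in> S; \<And>a v. v \<in> S \<Longrightarrow> L a v \<in> S;
      \<And>a v. v \<in> S \<Longrightarrow> R a v \<in> S; \<And>v. v \<in> S \<Longrightarrow> par v \<in> S;
      \<And>c v. v \<in> S \<Longrightarrow> sc c v \<in> S\<rbrakk> \<Longrightarrow> S = {0} \<or> S = M"
    and faithful: "(\<And>v. l a v = 0) \<Longrightarrow> (\<And>v. r a v = 0) \<Longrightarrow> a = 0"
begin

lemma neg: "- v = v + v" for v :: 'v
  using three[of v] by (simp add: add_eq_0_iff add.assoc)

lemma diff: "u - v = u + (v + v)" for u v :: 'v
  using neg[of v] by (metis diff_conv_add_uminus)

lemma three': "v + (v + v) = (0::'v)" "v + (v + (v + w)) = w" for v w :: 'v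
proof -
  show "v + (v + v) = 0" using three[of v] by (simp add: add.assoc)
  then show "v + (v + (v + w)) = w" by (metis add.assoc add.left_neutral)
qed

text \<open>
  A normal form for identities over the field with three elements: signs are removed, sums
  are sorted and triple summands cancel. Together with \<open>eq_by_difference\<close>, which adds or
  subtracts a known equation, it decides whether an equation is a combination, with
  coefficients \<open>1\<close> and \<open>-1\<close>, of given ones.
\<close>

lemmas char3_simps = neg diff three' add.assoc add.commute add.left_commute add_0_left add_0_right

lemma double_eq: "u + u = v + v \<Longrightarrow> u = v" for u v :: 'v
  by (metis neg neg_equal_iff_equal)

lemma eq_by_difference: "s = t \<Longrightarrow> A + t = B + s \<Longrightarrow> A = B" "s = t \<Longrightarrow> A + s = B + t \<Longrightarrow> A = B"
  for s t A B :: 'v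
  by auto

lemma op_zero [simp]: "l a 0 = 0" "r a 0 = 0" "L a 0 = 0" "R a 0 = 0" "par 0 = 0"
  using op_add(1)[of a 0 0] op_add(2)[of a 0 0] op_add(3)[of a 0 0] op_add(4)[of a 0 0]
    op_add(5)[of 0 0] by auto

lemma arg_zero [simp]: "l 0 v = 0" "r 0 v = 0" "L 0 v = 0" "R 0 v = 0"
  using arg_add(1)[of 0 0 v] arg_add(2)[of 0 0 v] arg_add(3)[of 0 0 v] arg_add(4)[of 0 0 v] by auto

lemma D_zero [simp]: "D 0 = 0" using D_add[of 0 0] by simp
lemma D_one [simp]: "D 1 = 0" using D_mult[of 1 1] by simp

lemmas adds = op_add arg_add

lemma M_zero: "0 \<in> M" using M_ops(1)[of 0 0] by simp

text \<open>
  The Peirce argument: with \<open>e\<close> idempotent, apply the hypothesis to \<open>e v\<close> and apply \<open>e\<close> to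
  the hypothesis; both sides of \<open>e f = f e\<close> appear, and \<open>2\<close> can be cancelled.
\<close>

lemma idempotent_unit:
  fixes f :: "'v \<Rightarrow> 'v"
  assumes e: "\<And>v. e (f v) + f (e v) = f v + f v" and ee: "\<And>v. e (e v) = e v"
    and add: "\<And>u v. e (u + v) = e u + e v"
  shows "e (f v) = f v \<and> f (e v) = f v"
proof -
  have "e (f (e v)) + f (e v) = f (e v) + f (e v)" using e[of "e v"] by (simp add: ee)
  then have 1: "e (f (e v)) = f (e v)" by (rule add_right_imp_eq)
  have "e (f v) + e (f (e v)) = e (f v) + e (f v)" using e[of v] by (metis add ee)
  then have "f (e v) = e (f v)" by (simp add: 1)
  then show ?thesis using e[of v] double_eq by metis
qed

lemma l_jordan: "l a (l b v) + l b (l a v) = l (a * b) v + l (a * b) v"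
  by (rule eq_by_difference[OF left_skew_ee[of a b v]],
    simp only: char3_simps; fail)

lemma r_jordan: "r a (r b v) + r b (r a v) = r (a * b) v + r (a * b) v"
  by (rule eq_by_difference[OF right_skew_ee[of b a v]],
    simp only: char3_simps; fail)

lemma L_jordan: "l a (L b v) + L b (l a v) = L (a * b) v + L (a * b) v"
  by (rule eq_by_difference[OF left_skew_eo[of a b v]],
    simp only: char3_simps; fail)

lemma R_jordan: "r a (R b v) + R b (r a v) = R (a * b) v + R (a * b) v"
  by (rule eq_by_difference[OF right_skew_eo[of b a v]],
    simp only: char3_simps; fail)

lemma even_action_D_nonzero:
  assumes "\<And>a v. l (D a) v = 0" "\<And>a v. r (D a) v = 0"
  shows False
proof -
  obtain a where "D a \<noteq> 0" using D_nonzero by blast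
  then show False using faithful[of "D a"] assms by blast
qed

text \<open>
  With the left action zero all associators with a vector vanish, so the right action is
  associative. Comparing \<open>x (a x)\<close> with \<open>(a x) x\<close>, which differ by \<open>D a\<close> in \<open>B\<close>, shows that
  \<open>D a\<close> acts as zero.
\<close>

lemma left_action_nonzero: "\<not> (\<forall>b v. l b v = 0 \<and> L b v = 0)"
proof
  assume z: "\<forall>b v. l b v = 0 \<and> L b v = 0"
  have R1: "R b (r a v) = R (a * b) v" for a b v using middle_right_eo[of b a v] z by simp
  have R2: "r a (R b v) = R (a * b) v" for a b v using right_skew_eo[of b a v] R1[of b a v] by simp
  have E: "r (\<gamma> * 1 * a + 2 * D 1 * a + 1 * D a) v = r (\<gamma> * a * 1 + 2 * D a * 1 + a * D 1) v" for a v
  proof -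
    have "R 1 (R a v) = R 1 (r a (R 1 v))" using R2[of a 1 v] by simp
    also have "\<dots> = R a (R 1 v)" using R1[of 1 a "R 1 v"] by simp
    finally have c: "R 1 (R a v) = R a (R 1 v)" .
    show ?thesis using right_sym_oo[of a 1 v] unfolding c
      by (simp only: diff_conv_add_uminus add_left_cancel neg_equal_iff_equal)
  qed
  have "r (D a) v = 0" for a v
    using E[of a v] by (simp only: arg_add mult_2 D_one mult_1_left mult_1_right mult_zero_left mult_zero_right
      add_0_right arg_zero) (simp only: add_cancel_left_right add.assoc add_left_cancel add_cancel_right_right)
  then show False using even_action_D_nonzero z by metis
qed

lemma right_action_nonzero: "\<not> (\<forall>b v. r b v = 0 \<and> R b v = 0)"
proof
  assume z: "\<forall>b v. r b v = 0 \<and> R b v = 0"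
  have R1: "l a (L b v) = L (a * b) v" for a b v using left_middle_eo[of a b v] z by simp
  have R2: "L b (l a v) = L (a * b) v" for a b v using left_skew_eo[of a b v] R1[of a b v] by simp
  have E: "l (\<gamma> * 1 * a + 2 * D 1 * a + 1 * D a) v = l (\<gamma> * a * 1 + 2 * D a * 1 + a * D 1) v" for a v
  proof -
    have "L 1 (L a v) = L 1 (l a (L 1 v))" using R1[of a 1 v] by simp
    also have "\<dots> = L a (L 1 v)" using R2[of 1 a "L 1 v"] by simp
    finally have c: "L 1 (L a v) = L a (L 1 v)" .
    show ?thesis using left_sym_oo[of 1 a v] unfolding c
      by (simp only: diff_conv_add_uminus add_right_cancel neg_equal_iff_equal)
  qed
  have "l (D a) v = 0" for a v
    using E[of a v] by (simp only: arg_add mult_2 D_one mult_1_left mult_1_right mult_zero_left mult_zero_right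
      add_0_right arg_zero) (simp only: add_cancel_left_right add.assoc add_left_cancel add_cancel_right_right)
  then show False using even_action_D_nonzero z by metis
qed

text \<open>
  Left multiplication by the unit commutes with everything, so its kernel is a subbimodule.
  It is not the whole of \<open>M\<close>, since \<open>1\<close> acts as the identity on the image of each left
  multiplication.
\<close>

lemma unital_left: assumes "v \<in> M" shows "l 1 v = v"
proof -
  have idem: "l 1 (l 1 u) = l 1 u" for u by (rule double_eq) (use l_jordan[of 1 1 u] in simp)
  have al: "l 1 (l b u) = l b u \<and> l b (l 1 u) = l b u" for b u
    by (rule idempotent_unit) (use l_jordan[of 1 b] idem op_add in auto)
  have aL: "l 1 (L b u) = L b u \<and> L b (l 1 u) = L b u" for b u
    by (rule idempotent_unit) (use L_jordan[of 1 b] idem op_add in auto)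
  have ar: "l 1 (r b u) = r b (l 1 u)" for b u using left_middle_ee[of 1 b u] al by simp
  have aR: "l 1 (R b u) = R b (l 1 u)" for b u
    using left_middle_eo[of 1 b "par u"] aL op_par_par by simp
  let ?K = "{v \<in> M. l 1 v = 0}"
  have "?K = {0} \<or> ?K = M"
  proof (rule irreducible)
    show "l a u \<in> ?K" "L a u \<in> ?K" if "u \<in> ?K" for a u
      using al[of a u] aL[of a u] that M_zero by auto
    show "r a u \<in> ?K" "R a u \<in> ?K" if "u \<in> ?K" for a u
      using ar[of a u] aR[of a u] that M_ops by auto
    show "par u \<in> ?K" if "u \<in> ?K" for u
      using par_op(1)[of 1 u] that M_ops by auto
  qed (auto simp: M_zero M_add op_add sc_op sc_M)
  \<comment> \<open>If \<open>1\<close> acted as zero from the left, so would every element.\<close>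
  moreover have "?K \<noteq> M"
  proof
    assume "?K = M"
    then have "l 1 (l b u) = 0" "l 1 (L b u) = 0" for b u using M_ops by blast+
    then show False using left_action_nonzero al aL by metis
  qed
  ultimately have K: "?K = {0}" by blast
  have "l 1 (v + - l 1 v) = 0" by (simp only: char3_simps adds idem)
  moreover have "v + - l 1 v \<in> M" using assms M_add M_ops neg by metis
  ultimately have "v + - l 1 v = 0" using K by blast
  then show ?thesis by simp
qed

lemma unital_right: assumes "v \<in> M" shows "r 1 v = v"
proof -
  have idem: "r 1 (r 1 u) = r 1 u" for u by (rule double_eq) (use r_jordan[of 1 1 u] in simp)
  have ar: "r 1 (r b u) = r b u \<and> r b (r 1 u) = r b u" for b u
    by (rule idempotent_unit) (use r_jordan[of 1 b] idem op_add in auto)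
  have aR: "r 1 (R b u) = R b u \<and> R b (r 1 u) = R b u" for b u
    by (rule idempotent_unit) (use R_jordan[of 1 b] idem op_add in auto)
  have al: "r 1 (l b u) = l b (r 1 u)" for b u using middle_right_ee[of 1 b u] ar by simp
  have aL: "r 1 (L b u) = L b (r 1 u)" for b u
  proof -
    have "L b u = l 1 (L b u)" "L b u = L b (l 1 u)"
       using unital_left M_ops L_jordan[of 1 b u] by auto
    then show ?thesis using middle_left_eo[of 1 b u] by simp
  qed
  let ?K = "{v \<in> M. r 1 v = 0}"
  have "?K = {0} \<or> ?K = M"
  proof (rule irreducible)
    show "r a u \<in> ?K" "R a u \<in> ?K" if "u \<in> ?K" for a u
      using ar[of a u] aR[of a u] that M_zero by auto
    show "l a u \<in> ?K" "L a u \<in> ?K" if "u \<in> ?K" for a u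
      using al[of a u] aL[of a u] that M_ops by auto
    show "par u \<in> ?K" if "u \<in> ?K" for u
      using par_op(2)[of 1 u] that M_ops by auto
  qed (auto simp: M_zero M_add op_add sc_op sc_M)
  moreover have "?K \<noteq> M"
  proof
    assume "?K = M"
    then have "r 1 (r b u) = 0" "r 1 (R b u) = 0" for b u using M_ops by blast+
    then show False using right_action_nonzero ar aR by metis
  qed
  ultimately have K: "?K = {0}" by blast
  have "r 1 (v + - r 1 v) = 0" by (simp only: char3_simps adds idem)
  moreover have "v + - r 1 v \<in> M" using assms M_add M_ops neg by metis
  ultimately have "v + - r 1 v = 0" using K by blast
  then show ?thesis by simp
qed

section \<open>Generators and Schur's lemma\<close>

abbreviation X where "X \<equiv> R 1"
abbreviation Z where "Z \<equiv> L 1"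

text \<open>
  Since \<open>bar b = b x\<close> and \<open>(v, b, x) = - (v, x, b)\<close>, twice the action of \<open>bar b\<close> is a Jordan
  product of those of \<open>b\<close> and \<open>x\<close>, and \<open>1/2 = -1\<close>. Hence \<open>\<Gamma>\<close> and \<open>x\<close> generate all
  multiplications.
\<close>

lemma R_eq: "R b v = - (X (r b v) + r b (X v))"
  by (rule eq_by_difference[OF R_jordan[of b 1 v]],
    simp only: mult_1_right; simp only: char3_simps; fail)

lemma L_eq: "L b v = - (Z (l b v) + l b (Z v))"
  by (rule eq_by_difference[OF L_jordan[of b 1 v]],
    simp only: mult_1_right; simp only: char3_simps; fail)

lemma irreducible_generators:
  assumes "S \<subseteq> M" "\<exists>v\<in>S. v \<noteq> 0" "\<And>u v. u \<in> S \<Longrightarrow> v \<in> S \<Longrightarrow> u + v \<in> S"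
   "\<And>a v. v \<in> S \<Longrightarrow> l a v \<in> S" "\<And>a v. v \<in> S \<Longrightarrow> r a v \<in> S" "\<And>v. v \<in> S \<Longrightarrow> Z v \<in> S"
   "\<And>v. v \<in> S \<Longrightarrow> X v \<in> S" "\<And>v. v \<in> S \<Longrightarrow> par v \<in> S"
  shows "S = M"
proof -
  have n: "- v \<in> S" if "v \<in> S" for v using that assms(3) neg by metis
  obtain v where "v \<in> S" "v \<noteq> 0" using assms by blast
  then have z: "0 \<in> S" using assms(4)[of v 0] by simp
  have "S = {0} \<or> S = M"
  proof (rule irreducible)
    show "L a u \<in> S" "R a u \<in> S" if "u \<in> S" for a u
      unfolding L_eq[of a] R_eq[of a] by (auto intro!: n assms(3-8) that simp del: minus_add_distrib)
    show "sc c u \<in> S" if "u \<in> S" for c u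
    proof -
      have "sc c u = l (em c) u"
        using sc_em[of c 1 u] unital_left[of u] that assms(1) by auto
      then show ?thesis using assms(4)[OF that] by simp
    qed
  qed (use assms z in auto)
  then show ?thesis using \<open>v \<in> S\<close> \<open>v \<noteq> 0\<close> by blast
qed

lemma schur_inj:
  assumes f: "\<And>u v. f (u + v) = f u + f v" "\<And>v. f v \<in> M" "\<And>a v. f (l a v) = l a (f v)"
    "\<And>a v. f (r a v) = r a (f v)"  "\<And>v. f (Z v) = Z (f v)" "\<And>v. f (X v) = X (f v)"
    "\<And>v. f (par v) = par (f v)"
   and nz: "\<exists>v\<in>M. f v \<noteq> 0" and v: "v \<in> M" "f v = 0"
  shows "v = 0"
proof (rule ccontr)
  assume "v \<noteq> 0"
  have "{v \<in> M. f v = 0} = M"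
    by (rule irreducible_generators) (use \<open>v \<noteq> 0\<close> v in \<open>auto simp: f M_add M_ops\<close>)
  then show False using nz by blast
qed

lemma schur_surj:
  assumes f: "\<And>u v. f (u + v) = f u + f v" "\<And>v. f v \<in> M" "\<And>a v. f (l a v) = l a (f v)"
    "\<And>a v. f (r a v) = r a (f v)"  "\<And>v. f (Z v) = Z (f v)" "\<And>v. f (X v) = X (f v)"
    "\<And>v. f (par v) = par (f v)"
   and nz: "\<exists>v\<in>M. f v \<noteq> 0" and v: "v \<in> M"
  shows "\<exists>u\<in>M. v = f u"
proof -
  have "f ` M = M"
  proof (rule irreducible_generators)
    show "u + w \<in> f ` M" if "u \<in> f ` M" "w \<in> f ` M" for u w
      using that f(1)[symmetric] M_add by force
    show "l a u \<in> f ` M" "r a u \<in> f ` M" "Z u \<in> f ` M" "X u \<in> f ` M" "par u \<in> f ` M"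
      if "u \<in> f ` M" for a u
      using that f(3-7)[symmetric] M_ops by (auto intro!: image_eqI)
  qed (use nz f in auto)
  then show ?thesis using v by blast
qed

section \<open>Left and right multiplications by even elements agree\<close>

definition \<phi> where "\<phi> a v = l a v - r a v"

text \<open>
  In any algebra \<open>[a, y z] - [a, y] z - y [a, z]\<close> is a combination of three associators,
  which alternativity identifies up to sign so that they add up to three times one of them.
  As \<open>a\<close> commutes with all of \<open>B\<close>, the commutator with \<open>a\<close> is therefore a bimodule
  endomorphism.
\<close>

lemma phi_l: "\<phi> a (l b v) = l b (\<phi> a v)"
  unfolding \<phi>_def
  by (rule eq_by_difference[OF left_middle_ee[of b a v]],
    rule eq_by_difference[OF l_jordan[of a b v]],
    simp only: mult.commute char3_simps adds; fail)

lemma phi_r: "\<phi> a (r b v) = r b (\<phi> a v)"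
  unfolding \<phi>_def
  by (rule eq_by_difference[OF middle_right_ee[of b a v]],
    rule eq_by_difference[OF r_jordan[of a b v]],
    simp only: mult.commute char3_simps adds; fail)

lemma phi_R: "\<phi> a (R b v) = R b (\<phi> a v)"
  unfolding \<phi>_def
  by (rule eq_by_difference[OF middle_right_eo[of b a v]],
    rule eq_by_difference[OF R_jordan[of a b v]],
    simp only: mult.commute char3_simps adds; fail)

lemma phi_L: "\<phi> a (L b v) = L b (\<phi> a v)"
  unfolding \<phi>_def
  by (rule eq_by_difference[OF middle_left_eo[of a b v]],
    rule eq_by_difference[OF L_jordan[of a b v]],
    simp only: mult.commute char3_simps adds; fail)

lemma op_neg: "l a (- v) = - l a v" "r a (- v) = - r a v" "L a (- v) = - L a v" "R a (- v) = - R a v"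
  "par (- v) = - par v"
  by (simp_all only: neg op_add)

lemma op_diff: "l a (u - v) = l a u - l a v" "r a (u - v) = r a u - r a v" "L a (u - v) = L a u - L a v"
   "R a (u - v) = R a u - R a v" "par (u - v) = par u - par v"
  by (simp_all only: diff op_add)

lemma op_one: "l a (l 1 v) = l a v" "L a (l 1 v) = L a v" "r a (l 1 v) = r a v" "R a (l 1 v) = R a v"
proof -
  show "l a (l 1 v) = l a v" using l_jordan[of 1 a v] unital_left[OF M_ops(1)] by simp
  show "L a (l 1 v) = L a v" using L_jordan[of 1 a v] unital_left[OF M_ops(3)] by simp
  show "r a (l 1 v) = r a v" using left_middle_ee[of 1 a v] unital_left[OF M_ops(1)] unital_left[OF M_ops(2)] by simp
  have "R a (r 1 v) = R a v" using R_jordan[of 1 a v] unital_right[OF M_ops(4)] by simp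
  then show "R a (l 1 v) = R a v" using middle_right_eo[of a 1 v] middle_right_eo[of 1 a v] unital_left[OF M_ops(4)] by simp
qed

lemma R_X_commutator: "R a (X v) + r (D a) v = X (R a v)"
  by (rule eq_by_difference[OF right_sym_oo[of a 1 v]],
    simp only: D_one mult_1_left mult_1_right mult_zero_left mult_zero_right add_0_right mult_2 char3_simps adds; fail)

lemma L_Z_commutator: "L a (Z v) = Z (L a v) + l (D a) v"
  by (rule eq_by_difference[OF left_sym_oo[of 1 a v]],
    simp only: D_one mult_1_left mult_1_right mult_zero_left mult_zero_right add_0_right mult_2 char3_simps adds; fail)

lemma right_middle_X: "R a (X v) - (r (\<gamma> * a) v + r (D a) v) = - (R a (Z (par v)) - Z (R a (par v)))"
  using right_middle_oo[of a 1 v] by (simp add: arg_add)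

lemma middle_left_Z: "R a (Z (par v)) - Z (R a (par v)) = - (l (\<gamma> * a) v + l (D a) v - Z (L a v))"
  using middle_left_oo[of a 1 v] by (simp add: arg_add)

lemma phi_M: "\<phi> a v \<in> M"
  unfolding \<phi>_def diff by (intro M_add M_ops)

lemma phi_square: "\<phi> (a * a) v = l a (\<phi> a v) + r a (\<phi> a v)"
  unfolding \<phi>_def
  by (rule eq_by_difference[OF l_jordan[of a a v]],
    rule eq_by_difference[OF r_jordan[of a a v]],
    rule eq_by_difference[OF middle_right_ee[of a a v]],
    simp only: char3_simps adds; fail)

text \<open>
  If \<open>\<phi> a\<close> is bijective, then \<open>l a + r a\<close> commutes with \<open>x\<close>, because composed with \<open>\<phi> a\<close> it
  is \<open>\<phi> (a a)\<close>. So both \<open>l a\<close> and \<open>r a\<close> commute with \<open>x\<close>, and then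
  \<open>(v, x, a x) = (v, a x, x)\<close> reduces to \<open>v (D a) = 0\<close>.
\<close>

lemma phi_zero_if:
  assumes "D a \<noteq> 0"
  shows "\<phi> a v = 0"
proof (rule ccontr)
  assume nz: "\<phi> a v \<noteq> 0"
  have phi1: "\<phi> a (l 1 v) = \<phi> a v" for v unfolding \<phi>_def op_one ..
  have surj: "\<exists>u\<in>M. w = \<phi> a u" if "w \<in> M" for w
  proof (rule schur_surj[of "\<phi> a"])
    show "\<phi> a (u + w) = \<phi> a u + \<phi> a w" for u w by (simp add: \<phi>_def op_add)
    show "\<phi> a (par w) = par (\<phi> a w)" for w by (simp add: \<phi>_def op_diff par_op)
    show "\<exists>v\<in>M. \<phi> a v \<noteq> 0" using nz phi1 M_ops by metis
  qed (use that in \<open>simp_all add: phi_M phi_l phi_r phi_L phi_R\<close>)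
  have h: "l a (X w) + r a (X w) = X (l a w) + X (r a w)" "l a (Z w) + r a (Z w) = Z (l a w) + Z (r a w)"
    if "w \<in> M" for w
  proof -
    obtain u where u: "w = \<phi> a u" using surj \<open>w \<in> M\<close> by blast
    have "l a (X w) + r a (X w) = \<phi> (a * a) (X u)"
      unfolding u phi_square by (simp add: phi_R)
    also have "\<dots> = X (\<phi> (a * a) u)" by (simp add: phi_R)
    also have "\<dots> = X (l a w) + X (r a w)" unfolding u phi_square by (simp add: op_add)
    finally show "l a (X w) + r a (X w) = X (l a w) + X (r a w)" .
    have "l a (Z w) + r a (Z w) = \<phi> (a * a) (Z u)"
      unfolding u phi_square by (simp add: phi_L)
    also have "\<dots> = Z (\<phi> (a * a) u)" by (simp add: phi_L)
    also have "\<dots> = Z (l a w) + Z (r a w)" unfolding u phi_square by (simp add: op_add)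
    finally show "l a (Z w) + r a (Z w) = Z (l a w) + Z (r a w)" .
  qed
  have rX: "r a (X w) = X (r a w)" if "w \<in> M" for w
    by (rule eq_by_difference[OF h(1)[OF that]],
    rule eq_by_difference[OF phi_R[of a 1 w, unfolded \<phi>_def]],
    simp only: char3_simps adds; fail)
  have lZ: "l a (Z w) = Z (l a w)" if "w \<in> M" for w
    by (rule eq_by_difference[OF h(2)[OF that]],
    rule eq_by_difference[OF phi_L[of a 1 w, unfolded \<phi>_def]],
    simp only: char3_simps adds; fail)
  have Ra: "R a w = X (r a w)" if "w \<in> M" for w
    unfolding R_eq[of a w] rX[OF that] by (simp only: char3_simps)
  have La: "L a w = Z (l a w)" if "w \<in> M" for w
    unfolding L_eq[of a w] lZ[OF that] by (simp only: char3_simps)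
  have 1: "r (D a) w = 0" if "w \<in> M" for w
    using R_X_commutator[of a w] by (simp add: Ra M_ops that rX)
  have 2: "l (D a) w = 0" if "w \<in> M" for w
    using L_Z_commutator[of a w] by (simp add: La M_ops that lZ)
  have "D a = 0"
    by (rule faithful) (metis 1 2 op_one M_ops)+
  then show False using assms by blast
qed

text \<open>
  Elements with \<open>D a = 0\<close> are differences of elements whose derivative is not zero.
\<close>

lemma phi_zero: "\<phi> a v = 0"
proof (cases "D a = 0")
  case True
  obtain b where "D b \<noteq> 0" using D_nonzero by blast
  moreover have "\<phi> (a + b) v = \<phi> a v + \<phi> b v" by (simp add: \<phi>_def arg_add)
  ultimately show ?thesis using phi_zero_if[of b v] phi_zero_if[of "a + b" v] True by (simp add: D_add)
qed (rule phi_zero_if)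

lemma r_eq: "r a v = l a v"
  using phi_zero[of a v] by (simp add: \<phi>_def)

section \<open>The even elements act associatively\<close>

definition commut where "commut b c v = l b (l c v) - l c (l b v)"

lemma l_mult: "l (a * b) v = - (l a (l b v) + l b (l a v))"
  by (rule eq_by_difference[OF l_jordan[of a b v]],
    simp only: char3_simps; fail)

text \<open>
  By \<open>l_mult\<close> each bracketing of \<open>b a c\<close> acts as an iterated Jordan product of \<open>l b\<close>, \<open>l a\<close>
  and \<open>l c\<close>. Two bracketings agree, and the difference of the two iterated products is the
  commutator of \<open>l a\<close> with \<open>[l b, l c]\<close>.
\<close>

lemma commut_l: "commut b c (l a v) = l a (commut b c v)"
proof -
  have "l ((b * a) * c) v = l (b * (a * c)) v" by (simp add: mult.assoc)
  note h = this[unfolded l_mult[of "b * a"] l_mult[of b "a * c"], unfolded l_mult[of b a] l_mult[of a c]]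
  show ?thesis unfolding commut_def
    by (rule eq_by_difference[OF h],
    simp only: char3_simps adds; fail)
qed

text \<open>
  The two ways of writing right multiplication by \<open>(c b) x = c (b x)\<close> by means of \<open>R_eq\<close>.
\<close>

lemma X_polarized: "l c (X (l b v)) + l b (X (l c v)) = X (l c (l b v)) + l b (l c (X v))"
  by (rule eq_by_difference[OF R_jordan[of c b v, unfolded R_eq[of "c * b"], unfolded R_eq[of b] r_eq l_mult[of c b]]],
    simp only: char3_simps adds; fail)

lemma Z_polarized: "l c (Z (l b v)) + l b (Z (l c v)) = Z (l c (l b v)) + l b (l c (Z v))"
  by (rule eq_by_difference[OF L_jordan[of c b v, unfolded L_eq[of "c * b"], unfolded L_eq[of b] l_mult[of c b]]],
    simp only: char3_simps adds; fail)

lemma commut_X: "commut b c (X v) = X (commut b c v)"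
  unfolding commut_def
  by (rule eq_by_difference[OF X_polarized[of b c v]],
    rule eq_by_difference[OF X_polarized[of c b v]],
    simp only: char3_simps adds; fail)

lemma commut_Z: "commut b c (Z v) = Z (commut b c v)"
  unfolding commut_def
  by (rule eq_by_difference[OF Z_polarized[of b c v]],
    rule eq_by_difference[OF Z_polarized[of c b v]],
    simp only: char3_simps adds; fail)

lemma commut_M: "commut a b v \<in> M"
  unfolding commut_def diff by (intro M_add M_ops)

text \<open>
  Let \<open>C = [b, c]\<close> be the commutator of the two multiplications. Both \<open>C\<close> and
  \<open>[b b, c] = 2 b C\<close> commute with \<open>l c\<close>, so \<open>C C = [b, c] C = 0\<close>, which is impossible for an
  injective \<open>C\<close>.
\<close>

lemma commut_zero: "commut b c v = 0"
proof (rule ccontr)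
  assume nz: "commut b c v \<noteq> 0"
  have nz': "\<exists>v\<in>M. commut b c v \<noteq> 0"
    using nz M_ops(1)[of 1 v] by (metis commut_l commut_M unital_left)
  have inj: "w = 0" if "w \<in> M" "commut b c w = 0" for w
  proof (rule schur_inj[of "commut b c"])
    show "commut b c (u + w) = commut b c u + commut b c w" for u w by (simp add: commut_def op_add)
    show "commut b c (par w) = par (commut b c w)" for w by (simp add: commut_def op_diff par_op)
  qed (use that nz' in \<open>simp_all add: r_eq commut_M commut_l commut_X commut_Z\<close>)
  have sq: "commut (b * b) c w = - l b (commut b c w)" for w
    unfolding commut_def l_mult[of b b]
    by (rule eq_by_difference[OF commut_l[of b c b w, unfolded commut_def]],
    simp only: char3_simps adds; fail)
  have "commut b c (commut b c w) = 0" for w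
  proof -
    have "l b (commut b c (l c w)) = l c (l b (commut b c w))"
      using commut_l[of "b * b" c c w] unfolding sq by (simp add: op_neg)
    then have "commut b c (l b (l c w)) = commut b c (l c (l b w))" by (simp add: commut_l)
    moreover have "commut b c (u - w) = commut b c u - commut b c w" for u w
      by (simp add: commut_def op_diff)
    ultimately have "commut b c (l b (l c w) - l c (l b w)) = 0" by simp
    then show ?thesis unfolding commut_def[of b c w] .
  qed
  then have "commut b c v = 0" using inj commut_M by blast
  then show False using nz by blast
qed

lemma l_comm: "l a (l b v) = l b (l a v)"
  using commut_zero[of a b v] by (simp add: commut_def)

lemma l_l: "l a (l b v) = l (a * b) v"
  unfolding l_mult l_comm[of b a] by (simp only: char3_simps)

section \<open>The operators \<open>T a\<close>\<close>

definition T where "T a v = l a (X v) - X (l a v)"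

lemma X_l: "X (l a v) = l a (X v) - T a v"
  by (simp add: T_def)

lemma T_add [simp]: "T a (u + v) = T a u + T a v" "T (a + b) v = T a v + T b v"
  by (simp_all add: T_def op_add arg_add)

lemma T_zero [simp]: "T a 0 = 0" by (simp add: T_def)
lemma T_minus: "T a (- v) = - T a v" by (simp add: T_def op_neg)
lemma T_M: "T a v \<in> M" unfolding T_def diff by (intro M_add M_ops)

lemma T_par: "par (T a v) = - T a (par v)"
  by (simp add: T_def op_diff op_neg par_op)

lemma T_l: "T a (l b v) = l b (T a v)"
  unfolding T_def
  by (rule eq_by_difference[OF X_polarized[of a b v]],
    simp only: l_comm[of b a] char3_simps adds; fail)

lemma T_mult: "T (a * b) v = l a (T b v) + l b (T a v)"
  unfolding T_def l_l[symmetric]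
  by (rule eq_by_difference[OF X_polarized[of a b v]],
    simp only: l_comm[of b a] char3_simps adds; fail)

text \<open>
  The commutator of \<open>X X\<close> with \<open>a\<close> comes from \<open>(v, x, a x) = (v, a x, x)\<close>, as \<open>x (a x)\<close> and
  \<open>(a x) x\<close> differ by \<open>D a\<close>.
\<close>

lemma XX_l: "X (X (l a v)) = l a (X (X v)) - l (D a) v"
  by (rule eq_by_difference[OF R_X_commutator[of a v, unfolded R_eq[of a] r_eq]],
    simp only: char3_simps adds; fail)

lemma T_X: "T a (X v) = l (D a) v - X (T a v)"
  unfolding T_def
  by (rule eq_by_difference[OF XX_l[of a v]],
    simp only: char3_simps adds; fail)

text \<open>
  The sign twisted left multiplication \<open>W\<close> by \<open>x\<close> obeys the same commutation rule with \<open>\<Gamma>\<close>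
  as \<open>X\<close>. Their difference \<open>E\<close> is, up to sign, the supercommutator with \<open>x\<close>.
\<close>

definition W where "W v = Z (par v)"
definition E where "E v = W v - X v"

lemma W_add [simp]: "W (u + v) = W u + W v" by (simp add: W_def op_add)
lemma W_M: "W v \<in> M" by (simp add: W_def M_ops)
lemma E_add [simp]: "E (u + v) = E u + E v" by (simp add: E_def op_add)
lemma E_M: "E v \<in> M" unfolding E_def diff by (intro M_add M_ops W_M)

lemma Z_l_par: "Z (l a (par v)) = W (l a v)"
  by (simp add: W_def par_op)

lemma W_l: "W (l a v) = l a (W v) - T a v"
proof -
  have "L a (par v) - l a (W v) = T a v"
    using left_middle_eo[of a 1 "par v"] by (simp add: op_par_par T_def W_def)
  note h = this[unfolded L_eq[of a] Z_l_par, folded W_def]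
  show ?thesis by (rule eq_by_difference[OF h],
    simp only: char3_simps adds; fail)
qed

lemma Z_X_par: "Z (X (par v)) = - W (X v)"
  by (simp add: W_def par_op op_neg)

lemma Z_Z: "Z (Z v) = - W (W v)"
  by (simp add: W_def par_op op_neg op_par_par)

lemma Z_l_Z: "Z (l a (Z v)) = - W (l a (W v))"
  by (simp add: W_def par_op op_neg op_par_par)

text \<open>The law \<open>(v, x, x) = \<plusminus>(x, v, x)\<close> in terms of \<open>W\<close>.\<close>

lemma XW_anticomm: "X (W v) + W (X v) = l \<gamma> v - X (X v)"
proof -
  have h: "X (X v) - l \<gamma> v = - (X (W v) - - W (X v))"
    using right_middle_X[of 1 v] by (simp add: r_eq Z_X_par W_def[symmetric])
  show ?thesis by (rule eq_by_difference[OF h],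
    simp only: char3_simps adds; fail)
qed

text \<open>The law \<open>(v, x, x) = (x, x, v)\<close>, where \<open>x x = \<gamma>\<close>.\<close>

lemma W_W: "W (W v) = X (X v) + l \<gamma> v"
proof -
  have h: "X (X v) - l \<gamma> v = l \<gamma> v - Z (Z v)"
    using right_middle_X[of 1 v] middle_left_Z[of 1 v] by (simp add: r_eq)
  show ?thesis by (rule eq_by_difference[OF h[unfolded Z_Z]],
    simp only: char3_simps adds; fail)
qed

lemma l_gamma: "l (\<gamma> * a) v = l a (l \<gamma> v)"
  by (simp add: l_l mult.commute)

text \<open>
  Compare \<open>(v, x, a x)\<close> with \<open>(x, a x, v)\<close>, and move all even multiplications to the left:
  the terms without \<open>T\<close> cancel in characteristic 3, by \<open>W_W\<close> and \<open>XX_l\<close>.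
\<close>

lemma T_E: "T a (E v) = 0"
proof -
  have h: "R a (X v) - (l (\<gamma> * a) v + l (D a) v) = l (\<gamma> * a) v + l (D a) v - Z (L a v)"
    using right_middle_X[of a v] middle_left_Z[of a v] by (simp add: r_eq)
  note h = h[unfolded L_eq[of a] R_eq[of a] r_eq, unfolded op_neg op_add Z_Z Z_l_Z]
  have 1: "W (W (l a v)) = l a (X (X v)) - l (D a) v + l a (l \<gamma> v)"
    by (simp add: W_W XX_l l_comm)
  have 2: "W (l a (W v)) = l a (X (X v)) + l a (l \<gamma> v) - T a (W v)"
    by (simp add: W_l W_W op_add)
  have 3: "X (l a (X v)) = l a (X (X v)) - T a (X v)"
    by (simp add: X_l)
  show ?thesis unfolding E_def diff T_add
    by (rule eq_by_difference[OF h],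
    simp only: 1 2 3 l_gamma, simp only: char3_simps adds; fail)
qed

lemma X_E: "X (E v) + E (X v) = l \<gamma> v"
  unfolding E_def
  by (rule eq_by_difference[OF XW_anticomm[of v]],
    simp only: char3_simps adds; fail)

text \<open>
  Apply \<open>T a\<close> to \<open>X E + E X = \<gamma>\<close> and use \<open>T a E = 0\<close>. This expresses \<open>E\<close> by \<open>T\<close> after
  multiplication by any \<open>D a\<close>, which is what makes \<open>x\<close> on the left redundant.
\<close>

lemma gamma_T: "l \<gamma> (T a v) = l (D a) (E v)"
proof -
  have "l \<gamma> (T a v) = T a (X (E v) + E (X v))"
    by (simp add: X_E T_l)
  also have "\<dots> = l (D a) (E v)"
    by (simp add: T_E T_X op_zero)
  finally show ?thesis .
qed

text \<open>An ideal that contains the image of \<open>D\<close> is stable under \<open>D\<close>.\<close>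

lemma one_in_ideal:
  assumes "\<And>a. D a \<in> I" "\<And>x y. x \<in> I \<Longrightarrow> y \<in> I \<Longrightarrow> x + y \<in> I" "\<And>a x. x \<in> I \<Longrightarrow> a * x \<in> I"
  shows "1 \<in> I"
proof -
  have "0 \<in> I" using assms(1)[of 0] by simp
  then have "I = {0} \<or> I = UNIV" by (rule D_simple) (use assms in auto)
  then show ?thesis using D_nonzero assms(1) by auto
qed

lemma D_nondegenerate:
  assumes "v \<in> M" "\<And>a. l (D a) v = 0"
  shows "v = 0"
proof -
  have "1 \<in> {c. l c v = 0}"
    by (rule one_in_ideal) (use assms in \<open>auto simp: arg_add l_l[symmetric]\<close>)
  then show ?thesis using unital_left[OF \<open>v \<in> M\<close>] by simp
qed

text \<open>
  For \<open>u\<close> in \<open>S\<close> the \<open>c\<close> with \<open>c E u\<close> in \<open>S\<close> form an ideal that contains all \<open>D a\<close>, by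
  \<open>gamma_T\<close>. Hence \<open>E u\<close> lies in \<open>S\<close>, and with it the left multiple of \<open>u\<close> by \<open>x\<close>.
\<close>

lemma irreducible_l_X:
  assumes S: "S \<subseteq> M" "\<exists>v\<in>S. v \<noteq> 0" "\<And>u v. u \<in> S \<Longrightarrow> v \<in> S \<Longrightarrow> u + v \<in> S"
   "\<And>a v. v \<in> S \<Longrightarrow> l a v \<in> S" "\<And>v. v \<in> S \<Longrightarrow> X v \<in> S" "\<And>v. v \<in> S \<Longrightarrow> par v \<in> S"
  shows "S = M"
proof (rule irreducible_generators)
  have n: "- v \<in> S" if "v \<in> S" for v using that S(3) neg by metis
  have T: "T a v \<in> S" if "v \<in> S" for a v
    unfolding T_def diff by (intro S(3-5) that)
  fix v assume v: "v \<in> S"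
  have "1 \<in> {c. l c (E (par v)) \<in> S}"
    by (rule one_in_ideal) (use S T v in \<open>auto simp: gamma_T[symmetric] arg_add l_l[symmetric]\<close>)
  then have "E (par v) \<in> S" using unital_left[OF E_M] by simp
  moreover have "Z v = X (par v) + E (par v)"
    using op_par_par v S(1) by (simp add: E_def W_def par_par)
  ultimately show "Z v \<in> S" using S v by auto
qed (use S in \<open>auto simp: r_eq\<close>)

lemma schur_X:
  assumes f: "\<And>u v. f (u + v) = f u + f v" "\<And>a v. f (l a v) = l a (f v)"
    "\<And>v. f (X v) = X (f v)" "\<And>v. f (par v) = par (f v)"
   and nz: "\<exists>v\<in>M. f v \<noteq> 0" and v: "v \<in> M" "f v = 0"
  shows "v = 0"
proof (rule ccontr)
  assume "v \<noteq> 0"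
  have "{v \<in> M. f v = 0} = M"
    by (rule irreducible_l_X) (use \<open>v \<noteq> 0\<close> v in \<open>auto simp: f M_add M_ops\<close>)
  then show False using nz by blast
qed

lemma TT_X: "T a (T b (X v)) + T b (T a (X v)) = X (T a (T b v) + T b (T a v))"
  by (simp only: T_X T_add diff T_l op_add char3_simps)

text \<open>
  The anticommutator of \<open>T a\<close> with \<open>T (a a) = 2 a T a\<close> is a multiple of \<open>a T a T a\<close> and
  commutes with \<open>X\<close>, as does \<open>T a T a\<close>. So \<open>[a, X] T a T a = T a T a T a\<close> is zero, and the
  central operator \<open>T a T a\<close> is nilpotent.
\<close>

lemma T_T: "T a (T a v) = 0"
proof (rule ccontr)
  assume nz: "T a (T a v) \<noteq> 0"
  have comm: "T a (T a (X w)) = X (T a (T a w))" for w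
    by (rule double_eq) (use TT_X[of a a w] in \<open>simp only: op_add\<close>)
  \<comment> \<open>\<open>T (a a) = 2 a T a\<close>, so the anticommutator is \<open>4 a T a T a = a T a T a\<close>.\<close>
  have T3: "T a (T a (T a w)) = 0" for w
  proof -
    have "T a (T (a * a) w) + T (a * a) (T a w) = l a (T a (T a w))" for w
      by (simp only: T_mult T_add T_l char3_simps)
    from TT_X[of a "a * a" w, unfolded this] have "X (l a (T a (T a w))) = l a (X (T a (T a w)))"
      by (simp only: comm)
    then show ?thesis by (simp add: X_l)
  qed
  have e: "T a (l 1 v) = T a v" using unital_left[OF T_M] by (simp add: T_l)
  have "\<exists>v\<in>M. T a (T a v) \<noteq> 0"
    by (intro bexI[of _ "l 1 v"]) (simp_all add: e nz M_ops)
  then have "T a (T a v) = 0"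
    by (rule schur_X[of "\<lambda>v. T a (T a v)", rotated 4]) (simp_all add: T_l comm T_par T_minus T_M T3)
  then show False using nz by blast
qed

lemma TT_anticomm: "T a (T b v) = - T b (T a v)"
  using T_T[of "a + b" v] by (simp add: T_T add_eq_0_iff)

section \<open>Products \<open>T a T b\<close> vanish\<close>

text \<open>
  The span of the vectors \<open>X^i w\<close>, \<open>i \<le> j\<close>, over the algebra generated by the \<open>l a\<close> and the
  \<open>T a\<close>. For homogeneous \<open>w \<noteq> 0\<close> these spans exhaust \<open>M\<close> by irreducibility, since \<open>X\<close> passes
  through that algebra and raises \<open>j\<close> by one.
\<close>

inductive_set pow_span for w :: 'v and j :: nat where
  power: "i \<le> j \<Longrightarrow> (X ^^ i) w \<in> pow_span w j"
| add: "u \<in> pow_span w j \<Longrightarrow> v \<in> pow_span w j \<Longrightarrow> u + v \<in> pow_span w j"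
| l: "u \<in> pow_span w j \<Longrightarrow> l a u \<in> pow_span w j"
| T: "u \<in> pow_span w j \<Longrightarrow> T a u \<in> pow_span w j"

lemma add_closed_minus:
  fixes S :: "'v set"
  assumes "\<And>u v. u \<in> S \<Longrightarrow> v \<in> S \<Longrightarrow> u + v \<in> S"
  shows "v \<in> S \<Longrightarrow> - v \<in> S" "u \<in> S \<Longrightarrow> v \<in> S \<Longrightarrow> u - v \<in> S"
  unfolding neg diff by (intro assms; assumption)+

lemmas pow_span_minus = add_closed_minus[of "pow_span w j" for w j, OF pow_span.add]

lemma pow_span_M: "w \<in> M \<Longrightarrow> pow_span w j \<subseteq> M"
proof
  fix z assume "w \<in> M" "z \<in> pow_span w j"
  from this(2,1) show "z \<in> M"
  proof induction
    case (power i)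
    then show ?case by (cases i) (auto simp: M_ops)
  qed (auto simp: M_add M_ops T_M)
qed

lemma pow_span_mono: "z \<in> pow_span w j \<Longrightarrow> j \<le> k \<Longrightarrow> z \<in> pow_span w k"
  by (induction rule: pow_span.induct) (auto intro: pow_span.intros)

lemma pow_span_X: "z \<in> pow_span w j \<Longrightarrow> X z \<in> pow_span w (Suc j)"
proof (induction rule: pow_span.induct)
  case (power i)
  then show ?case using pow_span.power[of "Suc i" "Suc j" w] by simp
next
  case (add u v)
  then show ?case by (simp add: op_add pow_span.add)
next
  case (l u a)
  then show ?case
    unfolding X_l by (intro pow_span_minus pow_span.l pow_span.T) (auto intro: pow_span_mono)
next
  case (T u a)
  have "X (T a u) = l (D a) u - T a (X u)" by (simp add: T_X)
  then show ?case using T by (auto intro!: pow_span_minus pow_span.l pow_span.T intro: pow_span_mono)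
qed

lemma par_X_power:
  assumes "par w = w \<or> par w = - w"
  shows "par ((X ^^ i) w) = (X ^^ i) w \<or> par ((X ^^ i) w) = - (X ^^ i) w"
  using assms by (induction i) (auto simp: par_op op_neg)

lemma pow_span_par: "z \<in> pow_span w j \<Longrightarrow> par w = w \<or> par w = - w \<Longrightarrow> par z \<in> pow_span w j"
proof (induction rule: pow_span.induct)
  case (power i)
  then show ?case using par_X_power[of w i] pow_span.power[of i j w] pow_span_minus by auto
qed (auto simp: op_add par_op T_par intro: pow_span.intros pow_span_minus)

lemma pow_span_all:
  assumes "w \<in> M" "w \<noteq> 0" "par w = w \<or> par w = - w"
  shows "(\<Union>j. pow_span w j) = M"
proof (rule irreducible_l_X)
  show "\<exists>v\<in>\<Union>j. pow_span w j. v \<noteq> 0" using pow_span.power[of 0 0 w] assms by auto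
  show "u + v \<in> (\<Union>j. pow_span w j)" if uv: "u \<in> (\<Union>j. pow_span w j)" "v \<in> (\<Union>j. pow_span w j)" for u v
  proof -
    obtain j k where "u \<in> pow_span w j" "v \<in> pow_span w k" using uv by blast
    then have "u + v \<in> pow_span w (max j k)" by (intro pow_span.add) (auto intro: pow_span_mono)
    then show ?thesis by blast
  qed
qed (use pow_span_M assms in \<open>auto intro: pow_span.l pow_span_par dest: pow_span_X\<close>)

text \<open>
  The vectors obtained from \<open>w\<close> by at most \<open>q\<close> derivatives and applications of \<open>X\<close> in total,
  followed by a form. The two-forms are the terms of the higher derivatives of \<open>da db\<close>.
  Commuting a two-form with \<open>X\<close> gives, by contraction with \<open>D\<close>, the one-form
  \<open>(D b) da - (D a) db\<close>, and commuting the one-form with \<open>X\<close> gives back two-forms; so the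
  family is closed under \<open>X\<close>.
\<close>

inductive_set form_span for w :: 'v and a b :: 'g and q :: nat where
  two_form: "z \<in> pow_span w k \<Longrightarrow> i + j + k \<le> q \<Longrightarrow> T ((D ^^ i) a) (T ((D ^^ j) b) z) \<in> form_span w a b q"
| one_form: "z \<in> pow_span w k \<Longrightarrow> i + j + k \<le> q \<Longrightarrow>
    l (D ((D ^^ j) b)) (T ((D ^^ i) a) z) - l (D ((D ^^ i) a)) (T ((D ^^ j) b) z) \<in> form_span w a b q"
| add: "u \<in> form_span w a b q \<Longrightarrow> v \<in> form_span w a b q \<Longrightarrow> u + v \<in> form_span w a b q"
| l: "u \<in> form_span w a b q \<Longrightarrow> l c u \<in> form_span w a b q"
| T: "u \<in> form_span w a b q \<Longrightarrow> T c u \<in> form_span w a b q"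

lemmas form_span_minus = add_closed_minus[of "form_span w a b q" for w a b q, OF form_span.add]

lemma form_span_mono: "z \<in> form_span w a b p \<Longrightarrow> p \<le> q \<Longrightarrow> z \<in> form_span w a b q"
  by (induction rule: form_span.induct) (auto intro: form_span.intros le_trans)

lemma form_span_X: "z \<in> form_span w a b q \<Longrightarrow> X z \<in> form_span w a b (Suc q)"
proof (induction rule: form_span.induct)
  case (two_form z k i j)
  let ?a = "(D ^^ i) a" and ?b = "(D ^^ j) b"
  have "X (T ?a (T ?b z)) = T ?a (T ?b (X z)) - (l (D ?b) (T ?a z) - l (D ?a) (T ?b z))"
    by (rule eq_by_difference[OF T_X[of ?a "T ?b z"]],
    rule eq_by_difference[OF T_X[of ?b z, THEN arg_cong, of "T ?a"]])
      (simp only: T_add diff T_l char3_simps)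
  moreover have "T ?a (T ?b (X z)) \<in> form_span w a b (Suc q)"
    by (rule form_span.two_form[where k = "Suc k"]) (use two_form in \<open>auto intro: pow_span_X\<close>)
  moreover have "l (D ?b) (T ?a z) - l (D ?a) (T ?b z) \<in> form_span w a b (Suc q)"
    by (rule form_span.one_form[where k = k]) (use two_form in auto)
  ultimately show ?case by (simp add: form_span_minus)
next
  case (one_form z k i j)
  let ?a = "(D ^^ i) a" and ?b = "(D ^^ j) b"
  have "X (l (D ?b) (T ?a z) - l (D ?a) (T ?b z)) =
      T (D ?a) (T ?b z) + T ?a (T (D ?b) z) - (l (D ?b) (T ?a (X z)) - l (D ?a) (T ?b (X z)))"
    by (simp add: T_X X_l op_diff TT_anticomm[of "D ?b"] l_comm[of "D ?b" "D ?a"])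
  moreover have "T ((D ^^ Suc i) a) (T ?b z) \<in> form_span w a b (Suc q)"
    by (rule form_span.two_form[where k = k]) (use one_form in auto)
  moreover have "T ?a (T ((D ^^ Suc j) b) z) \<in> form_span w a b (Suc q)"
    by (rule form_span.two_form[where k = k]) (use one_form in auto)
  moreover have "l (D ?b) (T ?a (X z)) - l (D ?a) (T ?b (X z)) \<in> form_span w a b (Suc q)"
    by (rule form_span.one_form[where k = "Suc k"]) (use one_form in \<open>auto intro: pow_span_X\<close>)
  ultimately show ?case by (simp add: form_span_minus form_span.add)
next
  case (add u v)
  then show ?case by (simp add: op_add form_span.add)
next
  case (l u c)
  then show ?case
    unfolding X_l by (intro form_span_minus form_span.l form_span.T) (auto intro: form_span_mono)
next
  case (T u c)
  have "X (T c u) = l (D c) u - T c (X u)" by (simp add: T_X)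
  then show ?case using T by (auto intro!: form_span_minus form_span.l form_span.T intro: form_span_mono)
qed

lemma pow_span_sub_form_span: "w' \<in> form_span w a b p \<Longrightarrow> z \<in> pow_span w' j \<Longrightarrow> z \<in> form_span w a b (p + j)"
proof (rotate_tac, induction rule: pow_span.induct)
  case (power i)
  have "(X ^^ i) w' \<in> form_span w a b (p + i)" using power(2) by (induction i) (auto intro: form_span_X)
  then show ?case using power(1) by (auto intro: form_span_mono)
qed (auto intro: form_span.intros)

text \<open>
  Each generating form contains operators \<open>T ((D ^^ i) a)\<close> or \<open>T ((D ^^ j) b)\<close>. Either they
  belong to the finitely many of order below \<open>N\<close>, or the derivatives have used up \<open>N\<close> of the
  total \<open>q\<close>, which leaves fewer powers of \<open>X\<close>.
\<close>

lemma form_span_sub: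
  assumes w: "w \<in> M"
    and S: "\<And>u v. u \<in> S \<Longrightarrow> v \<in> S \<Longrightarrow> u + v \<in> S" "\<And>a u. u \<in> S \<Longrightarrow> l a u \<in> S"
      "\<And>a u. u \<in> S \<Longrightarrow> T a u \<in> S"
    and low: "\<And>i u. i < N \<Longrightarrow> u \<in> M \<Longrightarrow> T ((D ^^ i) a) u \<in> S \<and> T ((D ^^ i) b) u \<in> S"
    and high: "\<And>k. k + N \<le> q \<Longrightarrow> pow_span w k \<subseteq> S"
  shows "form_span w a b q \<subseteq> S"
proof
  fix z assume "z \<in> form_span w a b q"
  then show "z \<in> S"
  proof induction
    case (two_form z k i j)
    show ?case
    proof (cases "i < N")
      case True
      then show ?thesis using low T_M by blast
    next
      case False
      then have "z \<in> S" using high[of k] two_form by auto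
      then show ?thesis by (intro S(3))
    qed
  next
    case (one_form z k i j)
    have "T ((D ^^ i) a) z \<in> S \<and> T ((D ^^ j) b) z \<in> S"
    proof (cases "i < N \<and> j < N")
      case True
      then show ?thesis using low pow_span_M[OF w] one_form by blast
    next
      case False
      then have "z \<in> S" using high[of k] one_form by auto
      then show ?thesis by (intro conjI S(3))
    qed
    then show ?case by (intro add_closed_minus(2)[of S, OF S(1)] S(2)) auto
  qed (use S in auto)
qed

lemma T_sum: "T a (\<Sum>c\<in>A. f c) = (\<Sum>c\<in>A. T a (f c))"
  by (induction A rule: infinite_finite_induct) auto

text \<open>
  Applying \<open>T c\<close> to a relation removes the summand with \<open>T c\<close>, since \<open>T c T c = 0\<close>; so
  \<open>T c S\<close> satisfies the hypothesis for the smaller set and vanishes. Then \<open>S\<close> satisfies it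
  for the smaller set as well.
\<close>

lemma nakayama:
  assumes "finite A" "\<And>s. s \<in> S \<Longrightarrow> - s \<in> S"
    "\<And>s. s \<in> S \<Longrightarrow> \<exists>f. (\<forall>c\<in>A. f c \<in> S) \<and> s = (\<Sum>c\<in>A. T c (f c))"
  shows "S \<subseteq> {0}"
  using assms
proof (induction A arbitrary: S rule: finite_induct)
  case empty
  then show ?case by auto
next
  case (insert c A)
  have z: "T c ` S \<subseteq> {0}"
  proof (rule insert.IH)
    fix s assume "s \<in> T c ` S"
    then obtain s' where s': "s' \<in> S" "s = T c s'" by blast
    then show "- s \<in> T c ` S" using insert.prems(1)[of s'] T_minus by (metis image_eqI)
    obtain f where f: "\<forall>c\<in>insert c A. f c \<in> S" "s' = (\<Sum>c\<in>insert c A. T c (f c))"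
      using insert.prems(2)[OF s'(1)] by blast
    have "s = (\<Sum>e\<in>A. T c (T e (f e)))"
      using insert.hyps by (simp add: s' f T_T T_sum)
    also have "\<dots> = (\<Sum>e\<in>A. T e (T c (- f e)))"
      by (simp add: TT_anticomm[of c] T_minus)
    finally have "s = (\<Sum>e\<in>A. T e (T c (- f e)))" .
    moreover have "T c (- f e) \<in> T c ` S" if "e \<in> A" for e
      using f(1) that insert.prems(1) by blast
    ultimately show "\<exists>f. (\<forall>e\<in>A. f e \<in> T c ` S) \<and> s = (\<Sum>e\<in>A. T e (f e))"
      by (intro exI[of _ "\<lambda>e. T c (- f e)"]) blast
  qed
  show ?case
  proof (rule insert.IH)
    fix s assume "s \<in> S"
    then show "- s \<in> S" by (rule insert.prems)
    obtain f where f: "\<forall>c\<in>insert c A. f c \<in> S" "s = (\<Sum>c\<in>insert c A. T c (f c))"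
      using insert.prems(2)[OF \<open>s \<in> S\<close>] by blast
    have "T c (f c) = 0" using f(1) z by blast
    then show "\<exists>f. (\<forall>c\<in>A. f c \<in> S) \<and> s = (\<Sum>c\<in>A. T c (f c))"
      using f insert.hyps by (intro exI[of _ f]) auto
  qed
qed

text \<open>
  Suppose \<open>T a T b w \<noteq> 0\<close> with \<open>w\<close> homogeneous. Then \<open>w\<close> lies in the span of the
  \<open>X^i T a T b w\<close> for \<open>i \<le> J\<close>, hence in \<open>form_span w a b J\<close>. Therefore a vector that needs
  \<open>j\<close> powers of \<open>X\<close> is a sum of vectors with a factor \<open>T ((D ^^ i) a)\<close> or \<open>T ((D ^^ i) b)\<close>,
  \<open>i \<le> J\<close>, and of vectors that need fewer powers of \<open>X\<close>. By induction on \<open>j\<close> all of \<open>M\<close> has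
  such factors, against \<open>nakayama\<close>.
\<close>

lemma TT_zero: "T a (T b v) = 0"
proof (rule ccontr)
  assume nz: "T a (T b v) \<noteq> 0"
  have "\<exists>w\<in>M. (par w = w \<or> par w = - w) \<and> T a (T b w) \<noteq> 0"
  proof (rule ccontr)
    assume c: "\<not> ?thesis"
    let ?v = "l 1 v"
    have v: "?v \<in> M" by (rule M_ops)
    have "?v + par ?v \<in> M" "par (?v + par ?v) = ?v + par ?v"
      by (simp_all add: M_add M_ops op_add par_par[OF v] add.commute)
    then have "T a (T b (?v + par ?v)) = 0" using c by blast
    moreover have "?v + - par ?v \<in> M" unfolding neg by (intro M_add M_ops)
    moreover have "par (?v + - par ?v) = - (?v + - par ?v)"
      by (simp only: op_add op_neg par_par[OF v] minus_add_distrib minus_minus add.commute)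
    ultimately have "T a (T b (?v + par ?v)) = 0" "T a (T b (?v + - par ?v)) = 0" using c by blast+
    moreover have "T a (T b ?v) + T a (T b ?v) = T a (T b (?v + par ?v)) + T a (T b (?v + - par ?v))"
      by (simp only: T_add char3_simps)
    ultimately have "T a (T b ?v) + T a (T b ?v) = 0" by simp
    then have "T a (T b ?v) = 0" using double_eq[of "T a (T b ?v)" 0] by simp
    then have "T a (T b v) = 0" using unital_left[OF T_M] by (simp add: T_l)
    then show False using nz by blast
  qed
  then obtain w where w: "w \<in> M" "par w = w \<or> par w = - w" "T a (T b w) \<noteq> 0" by blast
  let ?n = "T a (T b w)"
  have "par ?n = ?n \<or> par ?n = - ?n" using w(2) by (auto simp: T_par T_minus)
  then have "w \<in> (\<Union>j. pow_span ?n j)" using pow_span_all[of ?n] w T_M by blast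
  then obtain J where J: "w \<in> pow_span ?n J" by blast
  have "?n \<in> form_span w a b 0"
    using form_span.two_form[of w w 0 0 0 0 a b] pow_span.power[of 0 0 w] by simp
  then have wB: "w \<in> form_span w a b J" using pow_span_sub_form_span[OF _ J] by fastforce
  \<comment> \<open>All derivatives of order at most \<open>J\<close>: a vector with a higher derivative then needs fewer powers of \<open>X\<close>.\<close>
  define A where "A = (\<lambda>i. (D ^^ i) a) ` {..J} \<union> (\<lambda>i. (D ^^ i) b) ` {..J}"
  have fin: "finite A" by (simp add: A_def)
  define S where "S = {\<Sum>c\<in>A. T c (f c) | f. \<forall>c\<in>A. f c \<in> M}"
  have S_add: "u + v \<in> S" if uv: "u \<in> S" "v \<in> S" for u v
  proof -
    obtain f g where "u = (\<Sum>c\<in>A. T c (f c))" "v = (\<Sum>c\<in>A. T c (g c))" "\<forall>c\<in>A. f c \<in> M" "\<forall>c\<in>A. g c \<in> M"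
      using uv unfolding S_def by blast
    then show ?thesis unfolding S_def
      by (intro CollectI exI[of _ "\<lambda>c. f c + g c"]) (auto simp: sum.distrib M_add)
  qed
  have S_T1: "T c u \<in> S" if "c \<in> A" "u \<in> M" for c u
    unfolding S_def using that fin M_zero
    by (intro CollectI exI[of _ "\<lambda>e. if e = c then u else 0"]) (auto simp: if_distrib sum.delta cong: if_cong)
  have SM: "S \<subseteq> M"
    unfolding S_def
  proof clarify
    fix f show "(\<Sum>c\<in>A. T c (f c)) \<in> M" using fin by induction (auto simp: M_zero M_add T_M)
  qed
  have S_l: "l e u \<in> S" if u: "u \<in> S" for e u
  proof -
    obtain f where f: "u = (\<Sum>c\<in>A. T c (f c))" "\<forall>c\<in>A. f c \<in> M"
      using u unfolding S_def by blast
    have "l e (\<Sum>c\<in>A. T c (f c)) = (\<Sum>c\<in>A. T c (l e (f c)))"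
      using fin by induction (auto simp: op_add T_l)
    then show ?thesis unfolding S_def f(1)
      by (intro CollectI exI[of _ "\<lambda>c. l e (f c)"]) (auto simp: M_ops)
  qed
  have S_T: "T e u \<in> S" if u: "u \<in> S" for e u
  proof -
    obtain f where f: "u = (\<Sum>c\<in>A. T c (f c))" "\<forall>c\<in>A. f c \<in> M"
      using u unfolding S_def by blast
    have "T e (\<Sum>c\<in>A. T c (f c)) = (\<Sum>c\<in>A. T c (- T e (f c)))"
      by (simp add: T_sum TT_anticomm[of e] T_minus)
    moreover have "- T e (f c) \<in> M" for c unfolding neg by (intro M_add T_M)
    ultimately show ?thesis unfolding S_def f(1)
      by (intro CollectI exI[of _ "\<lambda>c. - T e (f c)"]) auto
  qed
  have pow_span_S: "pow_span w j \<subseteq> S" for j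
  proof (induction j rule: less_induct)
    case (less j)
    have "form_span w a b (J + j) \<subseteq> S"
    proof (rule form_span_sub[where N = "Suc J"])
      show "pow_span w k \<subseteq> S" if "k + Suc J \<le> J + j" for k using less[of k] that by simp
    qed (use w S_add S_l S_T S_T1 A_def in auto)
    then show ?case using pow_span_sub_form_span[OF wB] by blast
  qed
  have "w \<noteq> 0" using w(3) by auto
  then have "M \<subseteq> S" using pow_span_all[OF w(1) _ w(2)] pow_span_S by blast
  have "M \<subseteq> {0}"
  proof (rule nakayama[OF fin])
    show "- s \<in> M" if "s \<in> M" for s using that unfolding neg by (intro M_add)
    show "\<exists>f. (\<forall>c\<in>A. f c \<in> M) \<and> s = (\<Sum>c\<in>A. T c (f c))" if "s \<in> M" for s
      using that \<open>M \<subseteq> S\<close> unfolding S_def by blast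
  qed
  then show False using M_nonzero by blast
qed

section \<open>A homogeneous part that generates the bimodule\<close>

definition sg :: "bool \<Rightarrow> 'v \<Rightarrow> 'v" where "sg i v = (if i then - v else v)"

definition Hom where "Hom i = {v \<in> M. par v = sg i v}"

lemma sg_simps [simp]: "sg i (u + v) = sg i u + sg i v" "sg (\<not> i) v = - sg i v" "sg i (sg i v) = v"
  "sg i (- v) = - sg i v"  "sg i (u - v) = sg i u - sg i v" "sg i 0 = 0" "l a (sg i v) = sg i (l a v)" "X (sg i v) = sg i (X v)"
  by (simp_all add: sg_def op_neg)

lemma Hom_M: "v \<in> Hom i \<Longrightarrow> v \<in> M" by (simp add: Hom_def)
lemma Hom_add: "u \<in> Hom i \<Longrightarrow> v \<in> Hom i \<Longrightarrow> u + v \<in> Hom i" by (simp add: Hom_def M_add op_add)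
lemma Hom_zero: "0 \<in> Hom i" by (simp add: Hom_def M_zero)
lemma Hom_l: "v \<in> Hom i \<Longrightarrow> l a v \<in> Hom i" by (simp add: Hom_def M_ops par_op)
lemma Hom_X: "v \<in> Hom i \<Longrightarrow> X v \<in> Hom (\<not> i)" by (simp add: Hom_def M_ops par_op)
lemma Hom_T: "v \<in> Hom i \<Longrightarrow> T a v \<in> Hom (\<not> i)"
  unfolding Hom_def by (auto simp: T_M T_par) (simp add: sg_def T_minus)

lemma Hom_decomp: assumes "v \<in> M" shows "\<exists>u\<in>Hom i. \<exists>w\<in>Hom (\<not> i). v = u + w"
proof (intro bexI)
  \<comment> \<open>The projections onto the two parts, with \<open>1/2 = -1\<close>.\<close>
  let ?u = "- (v + sg i (par v))" and ?w = "- (v + - sg i (par v))"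
  show "v = ?u + ?w" by (simp only: char3_simps)
  have p: "par (sg i x) = sg i (par x)" for x by (simp add: sg_def op_neg)
  have m: "- u \<in> M" if "u \<in> M" for u using that unfolding neg by (intro M_add)
  have m': "u - w \<in> M" if "u \<in> M" "w \<in> M" for u w using that unfolding diff by (intro M_add)
  have s: "sg i u \<in> M" if "u \<in> M" for u using that m by (simp add: sg_def)
  show "?u \<in> Hom i"
    unfolding Hom_def using assms
    by (auto simp: op_add op_neg op_diff p par_par intro!: m m' s M_add M_ops simp del: minus_add_distrib)
  show "?w \<in> Hom (\<not> i)"
    unfolding Hom_def using assms
    by (auto simp: op_add op_neg op_diff p par_par intro!: m m' s M_add M_ops simp del: minus_add_distrib)
qed

lemma Hom_Int: assumes "v \<in> Hom i" "v \<in> Hom (\<not> i)" shows "v = 0"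
proof -
  have "v = - v" using assms by (auto simp: Hom_def sg_def split: if_splits)
  then have "v + v = 0 + 0" by (metis add.left_inverse add_0_left)
  then show ?thesis by (rule double_eq)
qed

text \<open>The map \<open>v \<mapsto> - (v, x, x)\<close>.\<close>

definition d where "d v = l \<gamma> v - X (X v)"

lemma d_l: "d (l a v) = l a (d v) + l (D a) v"
  unfolding d_def by (simp add: XX_l op_diff l_comm[of \<gamma> a])

lemma d_add: "d (u + v) = d u + d v" by (simp add: d_def op_add)

lemma Hom_d: "v \<in> Hom i \<Longrightarrow> d v \<in> Hom i"
  unfolding d_def diff using Hom_X[of "X v" "\<not> i"] Hom_X[of v i]
  by (intro Hom_add Hom_l) auto

text \<open>
  Let \<open>S\<close> be a \<open>d\<close>-stable \<open>\<Gamma>\<close>-submodule of vectors of one parity that are killed by all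
  \<open>T a\<close>. Then \<open>X\<close> commutes with \<open>\<Gamma>\<close> on \<open>S\<close>, and \<open>X X = \<gamma> - d\<close> maps \<open>S\<close> to itself. So
  \<open>S + X S\<close> is a subbimodule, and its homogeneous parts are \<open>S\<close> and \<open>X S\<close>. This is used for
  the space of all vectors killed by the \<open>T a\<close>, and again to show that this space is
  \<open>D\<close>-simple.
\<close>

lemma part_plus_X_part:
  assumes S: "S \<subseteq> Hom i" "\<And>u v. u \<in> S \<Longrightarrow> v \<in> S \<Longrightarrow> u + v \<in> S" "\<And>a v. v \<in> S \<Longrightarrow> l a v \<in> S"
    "\<And>v. v \<in> S \<Longrightarrow> d v \<in> S" and nz: "\<exists>v\<in>S. v \<noteq> 0" and T: "\<And>a v. v \<in> S \<Longrightarrow> T a v = 0"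
  shows "S = Hom i" "Hom (\<not> i) = X ` S"
proof -
  have n: "- v \<in> S" if "v \<in> S" for v unfolding neg by (intro S(2) that)
  obtain v0 where v0: "v0 \<in> S" using nz by blast
  have z: "0 \<in> S" using S(3)[OF v0, of 0] by simp
  let ?N = "{u + X w | u w. u \<in> S \<and> w \<in> S}"
  have N: "?N = M"
  proof (rule irreducible_l_X)
    show "?N \<subseteq> M" using S(1) Hom_M by (auto intro!: M_add M_ops)
    show "\<exists>v\<in>?N. v \<noteq> 0" using nz z by force
    fix v assume v: "v \<in> ?N"
    then obtain u w where uw: "u \<in> S" "w \<in> S" "v = u + X w" by blast
    show "l a v \<in> ?N" for a
    proof -
      have "l a v = l a u + X (l a w)" using T[OF uw(2), of a] by (simp add: uw op_add X_l)
      then show ?thesis using S(3)[OF uw(1), of a] S(3)[OF uw(2), of a] by blast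
    qed
    show "X v \<in> ?N"
    proof -
      have "X v = (l \<gamma> w + - d w) + X u" by (simp add: uw op_add d_def add.commute)
      moreover have "l \<gamma> w + - d w \<in> S" using uw by (intro S(2) S(3) n S(4))
      ultimately show ?thesis using uw(1) by blast
    qed
    show "par v \<in> ?N"
    proof -
      have "par v = sg i u + X (- sg i w)"
        using subsetD[OF S(1) uw(1)] subsetD[OF S(1) uw(2)]
        by (auto simp: uw Hom_def op_add op_neg par_op)
      moreover have "sg i u \<in> S" "- sg i w \<in> S" using uw n by (auto simp: sg_def)
      ultimately show ?thesis by blast
    qed
    fix v' assume "v' \<in> ?N"
    then obtain u' w' where uw': "u' \<in> S" "w' \<in> S" "v' = u' + X w'" by blast
    have "v + v' = (u + u') + X (w + w')" by (simp add: uw uw' op_add add_ac)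
    moreover have "u + u' \<in> S" "w + w' \<in> S" using uw uw' by (auto intro: S(2))
    ultimately show "v + v' \<in> ?N" by blast
  qed
  have part: "v \<in> S" if "v \<in> Hom i" for v
  proof -
    have "v \<in> ?N" using Hom_M[OF that] unfolding N .
    then obtain u w where uw: "u \<in> S" "w \<in> S" "v = u + X w" by blast
    have "X w = v + - u" by (simp add: uw)
    also have "\<dots> \<in> Hom i" using S(1) n[OF uw(1)] by (intro Hom_add that) blast
    finally have "X w \<in> Hom i" .
    moreover have "X w \<in> Hom (\<not> i)" using Hom_X uw(2) S(1) by blast
    ultimately have "X w = 0" by (rule Hom_Int)
    then show "v \<in> S" using uw by simp
  qed
  then show "S = Hom i" using S(1) by blast
  have "v \<in> X ` S" if "v \<in> Hom (\<not> i)" for v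
  proof -
    have "v \<in> ?N" using Hom_M[OF that] unfolding N .
    then obtain u w where uw: "u \<in> S" "w \<in> S" "v = u + X w" by blast
    have "X (- w) \<in> Hom (\<not> i)" using n[OF uw(2)] S(1) Hom_X by blast
    moreover have "u = v + X (- w)" by (simp add: uw op_neg)
    ultimately have "u \<in> Hom (\<not> i)" using that Hom_add by simp
    then have "u = 0" using uw(1) S(1) Hom_Int by blast
    then show ?thesis using uw by simp
  qed
  moreover have "X ` S \<subseteq> Hom (\<not> i)" using S(1) Hom_X by blast
  ultimately show "Hom (\<not> i) = X ` S" by blast
qed

lemma T_d: assumes "\<And>a. T a v = 0" shows "T a (d v) = 0"
proof -
  have "T a (X (X v)) = T (D a) v"
    by (simp add: T_X assms X_l)
  then show ?thesis by (simp add: d_def diff T_l assms)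
qed

text \<open>
  If some \<open>T a v\<close> is not zero, it is killed by all \<open>T b\<close>; otherwise every vector is.
\<close>

lemma Hom_cases: "\<exists>i. (\<forall>v\<in>Hom i. \<forall>a. T a v = 0) \<and> Hom (\<not> i) = X ` Hom i \<and> (\<exists>v\<in>Hom i. v \<noteq> 0)"
proof -
  have "\<exists>i. \<exists>v\<in>Hom i. v \<noteq> 0 \<and> (\<forall>a. T a v = 0)"
  proof (cases "\<exists>i. \<exists>v\<in>Hom i. \<exists>a. T a v \<noteq> 0")
    case True
    then obtain i v a where v: "v \<in> Hom i" "T a v \<noteq> 0" by blast
    then have "T a v \<in> Hom (\<not> i)" by (intro Hom_T)
    then show ?thesis using v TT_zero by blast
  next
    case False
    obtain v where "v \<in> M" "v \<noteq> 0" using M_nonzero by blast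
    then obtain u w where "u \<in> Hom True" "w \<in> Hom False" "u + w \<noteq> 0"
      using Hom_decomp[of v True] by auto
    then show ?thesis using False by (metis add.left_neutral)
  qed
  then obtain i v where v: "v \<in> Hom i" "v \<noteq> 0" "\<forall>a. T a v = 0" by blast
  let ?K = "{v \<in> Hom i. \<forall>a. T a v = 0}"
  have K: "?K = Hom i" "Hom (\<not> i) = X ` ?K"
    by (rule part_plus_X_part[of ?K i]; use v in \<open>auto simp: Hom_add Hom_l Hom_d T_l T_d\<close>)+
  then show ?thesis using v by (intro exI[of _ i]) auto
qed

end

text \<open>
  From here on \<open>i\<close> is the parity, in the original grading, of the part on which the \<open>T a\<close>
  vanish; \<open>sg i\<close> is the sign that a change of parity puts on the left action of odd
  elements.
\<close>

locale standard_part = alternative_action +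
  fixes i :: bool
  assumes T_Hom: "v \<in> Hom i \<Longrightarrow> T a v = 0"
    and Hom_X_image: "Hom (\<not> i) = X ` Hom i"
begin

text \<open>By \<open>gamma_T\<close> every \<open>D a\<close> annihilates \<open>E v\<close>.\<close>

lemma E_Hom: assumes "v \<in> Hom i" shows "E v = 0"
  by (rule D_nondegenerate[OF E_M]) (simp add: gamma_T[symmetric] T_Hom[OF assms])

lemma X_l_Hom: "v \<in> Hom i \<Longrightarrow> X (l a v) = l a (X v)"
  by (simp add: X_l T_Hom)

lemma W_Hom: "v \<in> Hom i \<Longrightarrow> W v = X v"
  using E_Hom[of v] by (simp add: E_def)

lemma Z_Hom: assumes "v \<in> Hom i" shows "Z v = sg i (X v)"
proof -
  have "W (sg i v) = Z v" using assms by (simp add: W_def Hom_def sg_def op_neg)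
  then show ?thesis using W_Hom[OF assms] by (auto simp: sg_def W_def op_neg)
qed

lemma Z_X_Hom: assumes "v \<in> Hom i" shows "Z (X v) = - sg i (X (X v) + l \<gamma> v)"
proof -
  have "Z (X v) = - sg i (W (X v))"
    using assms by (auto simp: W_def par_op op_neg Hom_def sg_def)
  moreover have "W (X v) = X (X v) + l \<gamma> v"
    using X_E[of v] E_Hom[OF assms] by (simp add: E_def algebra_simps)
  ultimately show ?thesis by simp
qed

lemma R_Hom: assumes "v \<in> Hom i" shows "R b v = X (l b v)"
  unfolding R_eq[of b] r_eq X_l_Hom[OF assms] by (simp only: char3_simps)

lemma L_Hom: assumes "v \<in> Hom i" shows "L b v = sg i (X (l b v))"
  unfolding L_eq[of b] Z_Hom[OF Hom_l[OF assms]] Z_Hom[OF assms] by (simp add: X_l_Hom[OF assms]) (simp only: char3_simps)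

lemma R_X_Hom: assumes "v \<in> Hom i"
  shows "R b (X v) = l \<gamma> (l b v) + (l b (d v) + l b (d v)) + l (D b) v"
  unfolding R_eq[of b] r_eq X_l_Hom[OF assms, symmetric] d_def XX_l l_comm[of \<gamma> b]
  by (simp only: char3_simps op_add)

lemma L_X_Hom: assumes "v \<in> Hom i"
  shows "L b (X v) = sg i (l \<gamma> (l b v) + l b (d v) + (l (D b) v + l (D b) v))"
proof -
  have "L b (X v) = sg i (X (X (l b v)) + l \<gamma> (l b v) + l b (X (X v) + l \<gamma> v))"
    unfolding L_eq[of b] X_l_Hom[OF assms, symmetric] Z_X_Hom[OF assms] Z_X_Hom[OF Hom_l[OF assms]]
    by (simp add: op_neg op_add op_diff)
  also have "X (X (l b v)) + l \<gamma> (l b v) + l b (X (X v) + l \<gamma> v) = l \<gamma> (l b v) + l b (d v) + (l (D b) v + l (D b) v)"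
    unfolding XX_l d_def l_comm[of \<gamma> b] by (simp only: char3_simps op_add)
  finally show ?thesis .
qed

text \<open>
  If \<open>X v = 0\<close>, then \<open>D a v = T a (X v) + X (T a v) = 0\<close> for all \<open>a\<close>.
\<close>

lemma X_inj: assumes "v \<in> Hom i" "X v = 0" shows "v = 0"
proof (rule D_nondegenerate)
  show "l (D a) v = 0" for a using T_X[of a v] assms by (simp add: T_Hom)
qed (use assms Hom_M in auto)

lemma faithful_Hom: assumes "\<And>v. v \<in> Hom i \<Longrightarrow> l a v = 0" shows "a = 0"
proof -
  have z: "l a v = 0" for v
  proof -
    obtain u w where uw: "u \<in> Hom i" "w \<in> Hom (\<not> i)" "l 1 v = u + w"
      using Hom_decomp[OF M_ops(1)[of 1 v]] by blast
    then obtain u' where u': "u' \<in> Hom i" "w = X u'" using Hom_X_image by blast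
    have "l a (X u') = 0" unfolding X_l_Hom[OF u'(1), symmetric] by (simp add: assms u')
    then have "l a (l 1 v) = 0" using assms uw u' by (simp add: op_add)
    then show ?thesis by (simp add: op_one)
  qed
  then show ?thesis by (rule faithful) (simp add: r_eq z)
qed

end

section \<open>Comparison with the model\<close>

text \<open>
  The superbimodule \<open>U\<close> will be \<open>V\<close> for \<open>i = False\<close> and the bimodule with changed parity for
  \<open>i = True\<close>; the factor \<open>sg i\<close> lets one argument serve both cases.
\<close>

locale standard_bimodule = standard_part D \<gamma> M l r L R par sc em i
  for D :: "'g::comm_ring_1 \<Rightarrow> 'g" and \<gamma> and M :: "'v::ab_group_add set" and l r L R par
    and sc :: "'f::field \<Rightarrow> 'v \<Rightarrow> 'v" and em i +
  fixes s :: "'f \<Rightarrow> 'g \<Rightarrow> 'g" and U :: "('f, 'g \<times> 'g, 'v) sbimodule"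
  assumes comm: "comm_algebra s"
    and D_lin: "D (s c a) = s c (D a)"
    and vs: "vector_space (scl U)"
    and scl: "v \<in> M \<Longrightarrow> scl U c v = l (s c 1) v"
    and parts: "part U 0 = Hom i" "part U 1 = Hom (\<not> i)"
    and lact: "v \<in> M \<Longrightarrow> lact U (a, b) v = l a v + sg i (L b v)"
    and ract: "v \<in> M \<Longrightarrow> ract U v (a, b) = l a v + R b v"
begin

abbreviation "even_part \<equiv> part_bimodule U 0"
abbreviation "d_assoc \<equiv> \<lambda>v. - right_associator (vector_type s D \<gamma>) U v (bar 1) (bar 1)"
abbreviation "model \<equiv> vector_type_bimodule D \<gamma> even_part d_assoc :: ('f, 'g \<times> 'g, 'v \<times> 'v) sbimodule"

lemma s_mult: "s c a = s c 1 * a"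
  using comm unfolding comm_algebra_def by (metis mult_1_left)

lemma s_zero: "s c 0 = 0"
  using comm by (simp add: comm_algebra_def module_iff_vector_space[symmetric] module.scale_zero_right)

lemma ract_even: "v \<in> M \<Longrightarrow> ract U v (a, 0) = l a v"
  and ract_bar: "v \<in> M \<Longrightarrow> ract U v (bar b) = R b v"
  and lact_even: "v \<in> M \<Longrightarrow> lact U (a, 0) v = l a v"
  by (simp_all add: ract lact)

lemma d_assoc: "v \<in> M \<Longrightarrow> d_assoc v = d v"
  by (simp add: right_associator_def vector_type_def ract_even ract_bar M_ops d_def)

lemma even_part_simps: "bscl even_part = scl U" "bcarrier even_part = Hom i"
  "v \<in> M \<Longrightarrow> bleft even_part a v = l a v" "v \<in> M \<Longrightarrow> bright even_part v a = l a v"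
  by (simp_all add: part_bimodule_def parts ract_even lact_even)

lemma odd_part_simps: "bscl (part_bimodule U 1) = scl U" "bcarrier (part_bimodule U 1) = Hom (\<not> i)"
  "v \<in> M \<Longrightarrow> bleft (part_bimodule U 1) a v = l a v" "v \<in> M \<Longrightarrow> bright (part_bimodule U 1) v a = l a v"
  by (simp_all add: part_bimodule_def parts ract_even lact_even)

lemma mod: "module (scl U)"
  using vs by (simp add: module_iff_vector_space)

text \<open>
  The action of the scalars through \<open>\<Gamma>\<close>. It is kept folded because the equation
  \<open>s c a = s c 1 * a\<close> loops as a rewrite rule.
\<close>

definition scalar where "scalar c = s c 1"

lemma l_scale: "l (s c a) v = l (scalar c) (l a v)"
  by (subst s_mult) (simp add: l_l scalar_def)

lemma scl_eq: "v \<in> M \<Longrightarrow> scl U c v = l (scalar c) v"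
  by (simp add: scalar_def scl)

lemma l_scalar: "l a (l (scalar c) v) = l (scalar c) (l a v)"
  by (rule l_comm)

lemma D_scalar: "D (scalar c) = 0"
  by (simp add: scalar_def D_lin s_zero)

lemma Hom_scl: "v \<in> Hom i \<Longrightarrow> scl U c v \<in> Hom i"
  by (simp add: scl_eq Hom_M Hom_l)

lemma Hom_subspace: "module.subspace (scl U) (Hom i)"
  by (auto simp: module.subspace_def[OF mod] Hom_zero Hom_add Hom_scl)

lemma even_part_is_bimodule: "is_bimodule s even_part"
  unfolding is_bimodule_def bilinear_on_def linear_on_def
  using vs Hom_subspace
  by (auto simp: even_part_simps Hom_M M_add Hom_add Hom_l Hom_scl op_add arg_add scl_eq M_ops l_scale l_scalar)

lemma d_M: "d v \<in> M"
  unfolding d_def diff by (intro M_add M_ops)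

lemma d_scl: "v \<in> M \<Longrightarrow> d (scl U c v) = scl U c (d v)"
  by (simp add: scl_eq d_l D_scalar d_M)

lemma even_part_D_bimodule: "D_bimodule s D even_part d_assoc"
proof -
  have lin: "linear_on (Hom i) (scl U) (scl U) d_assoc"
    unfolding linear_on_def by (simp add: d_assoc Hom_M M_add d_add d_scl Hom_scl[THEN Hom_M])
  have "derivation_on (ext_carrier even_part) (ext_scl s even_part) (ext_mul even_part) (\<lambda>(a, v). (D a, d_assoc v))"
    unfolding derivation_on_def linear_on_def ext_carrier_def ext_scl_def ext_mul_def
    by (auto simp: even_part_simps d_assoc Hom_M M_add d_add d_scl Hom_scl[THEN Hom_M] D_add D_lin D_mult d_l M_ops d_M Hom_d
       Hom_add Hom_l add_ac)
  then show ?thesis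
    unfolding D_bimodule_def using even_part_is_bimodule lin by (auto simp: even_part_simps d_assoc Hom_M Hom_d)
qed

text \<open>
  A nonzero \<open>d\<close>-stable submodule of the even part is one of the sets \<open>S\<close> in
  \<open>part_plus_X_part\<close>.
\<close>

lemma even_part_D_simple: "D_simple_bimodule even_part d_assoc"
  unfolding D_simple_bimodule_def even_part_simps
proof (intro allI impI, elim conjE)
  fix S assume S: "module.subspace (scl U) S" "S \<subseteq> Hom i"
    "\<forall>a. \<forall>v\<in>S. bleft even_part a v \<in> S \<and> bright even_part v a \<in> S" "d_assoc ` S \<subseteq> S"
  have SM: "v \<in> M" if "v \<in> S" for v using that S(2) Hom_M by blast
  show "S = {0} \<or> S = Hom i"
  proof (cases "\<exists>v\<in>S. v \<noteq> 0")
    case True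
    have "S = Hom i"
    proof (rule part_plus_X_part(1)[OF S(2) _ _ _ True])
      show "u + v \<in> S" if "u \<in> S" "v \<in> S" for u v
        using S(1) that by (simp add: module.subspace_def[OF mod])
      show "l a v \<in> S" if "v \<in> S" for a v
        using S(3) that SM even_part_simps(3) by metis
      show "d v \<in> S" if "v \<in> S" for v
        using S(4) that d_assoc[OF SM[OF that]] by auto
      show "T a v = 0" if "v \<in> S" for a v using that S(2) T_Hom by blast
    qed
    then show ?thesis ..
  next
    case False
    then show ?thesis using S(1) by (auto simp: module.subspace_def[OF mod])
  qed
qed

lemma even_part_faithful: "faithful_bimodule even_part"
  unfolding faithful_bimodule_def
  using faithful_Hom by (auto simp: even_part_simps Hom_M)

lemma even_part_assoc_comm: "assoc_comm_bimodule even_part"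
  unfolding assoc_comm_bimodule_def ext_carrier_def ext_mul_def
  by (auto simp: even_part_simps Hom_M M_ops M_add op_add l_l add_ac mult_ac)

lemma X_inj_on: "inj_on X (Hom i)"
proof (rule inj_onI)
  fix u v assume uv: "u \<in> Hom i" "v \<in> Hom i" "X u = X v"
  have "u - v \<in> Hom i" unfolding diff by (intro Hom_add uv)
  moreover have "X (u - v) = 0" by (simp add: op_diff uv)
  ultimately have "u - v = 0" by (rule X_inj)
  then show "u = v" by simp
qed

lemma even_part_iso_odd_part: "bimodule_iso even_part (part_bimodule U 1) (\<lambda>v. ract U v (bar 1))"
proof -
  have "bij_betw (\<lambda>v. ract U v (bar 1)) (Hom i) (Hom (\<not> i))"
  proof -
    have "bij_betw X (Hom i) (Hom (\<not> i))"
      by (simp add: bij_betw_def X_inj_on Hom_X_image)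
    then show ?thesis by (subst bij_betw_cong[of _ _ X]) (simp_all add: ract_bar Hom_M)
  qed
  then show ?thesis
    unfolding bimodule_iso_def linear_on_def
    by (simp add: even_part_simps odd_part_simps ract_bar Hom_M M_add M_ops op_add X_l_Hom scl_eq)
qed

lemma odd_part_eq_image: "part U 1 = (\<lambda>v. ract U v (bar 1)) ` part U 0"
  unfolding parts Hom_X_image by (rule image_cong) (simp_all add: ract_bar Hom_M)

lemma total_U: "total U = M"
  unfolding total_def parts using Hom_decomp[of _ i] Hom_M M_add by fast

lemma total_model: "total model = Hom i \<times> Hom i"
  unfolding total_def vector_type_bimodule_def by (auto simp: even_part_simps Hom_zero)

lemma scl_2: "scl U 2 v = v + v"
proof -
  have "scl U (1 + 1) v = scl U 1 v + scl U 1 v" by (rule module.scale_left_distrib[OF mod])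
  then show ?thesis by (simp add: module.scale_one[OF mod])
qed

text \<open>
  Every vector is uniquely \<open>u + X w\<close> with \<open>u\<close>, \<open>w\<close> in the even part of \<open>U\<close>, and the
  isomorphism sends it to \<open>(u, w)\<close>.
\<close>

lemma iso_model: "isomorphic_superbimodules (vector_type s D \<gamma>) U model"
proof -
  let ?\<psi> = "\<lambda>(u, w). u + X w"
  define \<phi> where "\<phi> = inv_into (Hom i \<times> Hom i) ?\<psi>"
  have inj: "inj_on ?\<psi> (Hom i \<times> Hom i)"
  proof (rule inj_onI, clarsimp)
    fix u w u' w' assume h: "u \<in> Hom i" "w \<in> Hom i" "u' \<in> Hom i" "w' \<in> Hom i" "u + X w = u' + X w'"
    have "u - u' = X (w' - w)" using h(5) by (simp add: op_diff algebra_simps)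
    moreover have "u - u' \<in> Hom i" unfolding diff by (intro Hom_add h)
    moreover have "w' - w \<in> Hom i" unfolding diff by (intro Hom_add h)
    ultimately have "u - u' = 0" using Hom_X Hom_Int by metis
    then have "u = u'" by simp
    then show "u = u' \<and> w = w'" using h X_inj_on by (auto dest: inj_onD)
  qed
  have surj: "\<exists>u\<in>Hom i. \<exists>w\<in>Hom i. v = u + X w" if "v \<in> M" for v
    using Hom_decomp[OF that, of i] unfolding Hom_X_image by auto
  have \<phi>: "\<phi> (u + X w) = (u, w)" if "u \<in> Hom i" "w \<in> Hom i" for u w
    using inv_into_f_f[OF inj, of "(u, w)"] that unfolding \<phi>_def by simp
  have \<phi>1: "\<phi> u = (u, 0)" if "u \<in> Hom i" for u using \<phi>[OF that Hom_zero] by simp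
  have \<phi>2: "\<phi> (X w) = (0, w)" if "w \<in> Hom i" for w using \<phi>[OF Hom_zero that] by simp
  have M: "u + X w \<in> M" if "u \<in> Hom i" for u w using that by (intro M_add M_ops Hom_M)
  have lin: "linear_on M (scl U) (scl model) \<phi>"
    unfolding linear_on_def
  proof (intro conjI ballI allI)
    fix x y assume "x \<in> M" "y \<in> M"
    then obtain u w u' w' where h: "u \<in> Hom i" "w \<in> Hom i" "u' \<in> Hom i" "w' \<in> Hom i"
      "x = u + X w" "y = u' + X w'" using surj by metis
    have e: "x + y = (u + u') + X (w + w')" by (simp add: h op_add add_ac)
    have "\<phi> (x + y) = (u + u', w + w')" unfolding e by (rule \<phi>) (simp_all add: h Hom_add)
    then show "\<phi> (x + y) = \<phi> x + \<phi> y" unfolding h(5,6) by (simp add: \<phi> h)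
  next
    fix c x assume "x \<in> M"
    then obtain u w where h: "u \<in> Hom i" "w \<in> Hom i" "x = u + X w" using surj by metis
    have e: "scl U c x = scl U c u + X (scl U c w)"
      using h by (simp add: scl_eq M Hom_M op_add X_l_Hom)
    have "\<phi> (scl U c x) = (scl U c u, scl U c w)" unfolding e by (rule \<phi>) (simp_all add: h Hom_scl)
    then show "\<phi> (scl U c x) = scl model c (\<phi> x)"
      by (simp add: \<phi> h vector_type_bimodule_def even_part_simps)
  qed
  have bij: "bij_betw \<phi> M (Hom i \<times> Hom i)"
  proof (rule bij_betw_byWitness[where f' = ?\<psi>])
    show "\<phi> ` M \<subseteq> Hom i \<times> Hom i"
    proof
      fix y assume "y \<in> \<phi> ` M"
      then obtain x where x: "x \<in> M" "y = \<phi> x" by blast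
      then obtain u w where "u \<in> Hom i" "w \<in> Hom i" "x = u + X w" using surj by metis
      then show "y \<in> Hom i \<times> Hom i" by (simp add: x \<phi>)
    qed
    show "?\<psi> ` (Hom i \<times> Hom i) \<subseteq> M" using M by auto
    show "\<forall>x\<in>M. ?\<psi> (\<phi> x) = x"
    proof
      fix x assume "x \<in> M"
      then obtain u w where "u \<in> Hom i" "w \<in> Hom i" "x = u + X w" using surj by metis
      then show "?\<psi> (\<phi> x) = x" by (simp add: \<phi>)
    qed
    show "\<forall>y\<in>Hom i \<times> Hom i. \<phi> (?\<psi> y) = y" by (auto simp: \<phi>)
  qed
  have grad: "\<phi> ` part U j \<subseteq> part model j" for j
  proof (cases j)
    case zero
    then show ?thesis by (auto simp: parts \<phi>1 vector_type_bimodule_def even_part_simps)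
  next
    case one
    then show ?thesis by (auto simp: parts \<phi>2 vector_type_bimodule_def even_part_simps Hom_X_image)
  qed
  have act: "\<phi> (lact U (a, b) x) = lact model (a, b) (\<phi> x) \<and> \<phi> (ract U x (a, b)) = ract model (\<phi> x) (a, b)"
    if x: "x \<in> M" for a b x
  proof -
    obtain u w where h: "u \<in> Hom i" "w \<in> Hom i" "x = u + X w" using surj[OF x] by blast
    note mem = h(1,2) Hom_l Hom_d Hom_add
    have "lact U (a, b) x = (l a u + (l \<gamma> (l b w) + l b (d w) + (l (D b) w + l (D b) w))) + X (l a w + l b u)"
      unfolding h(3) lact[OF M[OF h(1)]] op_add L_Hom[OF h(1)] L_X_Hom[OF h(2)]
        X_l_Hom[OF h(1)] X_l_Hom[OF h(2)] sg_simps by (simp only: add_ac)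
    then have 1: "\<phi> (lact U (a, b) x) = (l a u + (l \<gamma> (l b w) + l b (d w) + (l (D b) w + l (D b) w)), l a w + l b u)"
      by (simp only: \<phi> mem)
    have "ract U x (a, b) = (l a u + (l \<gamma> (l b w) + (l b (d w) + l b (d w)) + l (D b) w)) + X (l a w + l b u)"
      unfolding h(3) ract[OF M[OF h(1)]] op_add R_Hom[OF h(1), of b] R_X_Hom[OF h(2)]
        X_l_Hom[OF h(1)] X_l_Hom[OF h(2)] by (simp only: add_ac)
    then have 2: "\<phi> (ract U x (a, b)) = (l a u + (l \<gamma> (l b w) + (l b (d w) + l b (d w)) + l (D b) w), l a w + l b u)"
      by (simp only: \<phi> mem)
    note uM = h(1)[THEN Hom_M] and wM = h(2)[THEN Hom_M]
    have 3: "\<phi> x = (u, w)" unfolding h(3) by (rule \<phi>[OF h(1,2)])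
    have 4: "lact model (a, b) (u, w) =
        (l a u + (l (2 * D b) w + l b (d w) + l (\<gamma> * b) w), l a w + l b u)"
      by (simp add: vector_type_bimodule_def even_part_simps uM wM d_M d_assoc)
    have 5: "ract model (u, w) (a, b) =
        (l a u + (scl U 2 (l b (d w)) + l (D b) w + l \<gamma> (l b w)), l a w + l b u)"
      by (simp add: vector_type_bimodule_def even_part_simps uM wM d_M M_ops d_assoc)
    have 6: "l (2 * D b) w = l (D b) w + l (D b) w"
      unfolding mult_2 arg_add ..
    show ?thesis
      unfolding 1 2 3 4 5 6 scl_2 unfolding l_l[symmetric] by (simp only: add_ac)
  qed
  show ?thesis
    unfolding isomorphic_superbimodules_def total_U total_model
    using lin bij grad act by (intro exI[of _ \<phi>]) auto
qed

lemmas conclusion = even_part_D_bimodule even_part_D_simple even_part_faithful even_part_assoc_comm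
  odd_part_eq_image even_part_iso_odd_part iso_model

end

section \<open>From superbimodules to operators\<close>

lemma bit_cases: "(i::bit) = 0 \<or> i = 1" by (cases i) auto

lemma subspace_total:
  assumes "superspace V"
  shows "module.subspace (scl V) (total V)"
proof -
  interpret module "scl V" using assms by (simp add: superspace_def module_iff_vector_space)
  have sub: "subspace (part V i)" for i using assms by (simp add: superspace_def)
  show ?thesis
    unfolding subspace_def
  proof (intro conjI ballI allI)
    show "0 \<in> total V"
      unfolding total_def using subspace_0[OF sub[of 0]] subspace_0[OF sub[of 1]] by force
  next
    fix u v assume "u \<in> total V" "v \<in> total V"
    then obtain x y x' y' where h: "x \<in> part V 0" "y \<in> part V 1" "x' \<in> part V 0" "y' \<in> part V 1"
      "u = x + y" "v = x' + y'" unfolding total_def by blast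
    have "u + v = (x + x') + (y + y')" using h by (simp add: add_ac)
    moreover have "x + x' \<in> part V 0" "y + y' \<in> part V 1" using h by (auto intro: subspace_add[OF sub])
    ultimately show "u + v \<in> total V" unfolding total_def by blast
  next
    fix c u assume "u \<in> total V"
    then obtain x y where h: "x \<in> part V 0" "y \<in> part V 1" "u = x + y" unfolding total_def by blast
    have "scl V c u = scl V c x + scl V c y" using h by (simp add: scale_right_distrib)
    moreover have "scl V c x \<in> part V 0" "scl V c y \<in> part V 1" using h by (auto intro: subspace_scale[OF sub])
    ultimately show "scl V c u \<in> total V" unfolding total_def by blast
  qed
qed

lemma component_eq:
  assumes V: "superspace V" and "x \<in> part V 0" "y \<in> part V 1"
  shows "component V 0 (x + y) = x" "component V 1 (x + y) = y"
proof -
  have mod: "module (scl V)" using V by (simp add: superspace_def module_iff_vector_space)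
  have sub: "u - w \<in> part V i" if "u \<in> part V i" "w \<in> part V i" for u w i
    using module.subspace_diff[OF mod] V that unfolding superspace_def by blast
  have uniq: "u = w" if "u \<in> part V 0" "w \<in> part V 0" "u - w \<in> part V 1" for u w
  proof -
    have "u - w \<in> part V 0 \<inter> part V 1" using sub[OF that(1,2)] that(3) by blast
    then have "u - w = 0" using V unfolding superspace_def by blast
    then show ?thesis by simp
  qed
  show "component V 0 (x + y) = x"
    unfolding component_def
  proof (rule the_equality)
    fix z assume z: "z \<in> part V 0 \<and> x + y - z \<in> part V (0 + 1)"
    have "(x + y - z) - y \<in> part V 1" using z assms by (intro sub[of "x + y - z"]) auto
    then show "z = x" using uniq[of x z] z assms by (simp add: algebra_simps)
  qed (use assms in auto)
  show "component V 1 (x + y) = y"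
    unfolding component_def
  proof (rule the_equality)
    fix z assume z: "z \<in> part V 1 \<and> x + y - z \<in> part V (1 + 1)"
    have "y - z \<in> part V 1" using z assms by (intro sub) auto
    moreover have "x + y - z \<in> part V 0" using z by simp
    moreover have "(x + y - z) - x = y - z" by simp
    ultimately have "x + y - z = x" using uniq[of "x + y - z" x] assms by simp
    then show "z = y" by (simp add: algebra_simps)
  qed (use assms in auto)
qed

text \<open>
  The projection \<open>p\<close> from the ambient space onto \<open>V\<close> extends the multiplication operators to
  the whole type.
\<close>

locale faithful_irreducible_bimodule =
  fixes s :: "'f::field \<Rightarrow> 'g::comm_ring_1 \<Rightarrow> 'g" and D :: "'g \<Rightarrow> 'g" and \<gamma> :: 'g
    and V :: "('f, 'g \<times> 'g, 'v::ab_group_add) sbimodule" and B and p :: "'v \<Rightarrow> 'v"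
  assumes char: "CHAR('f) = 3"
    and comm: "comm_algebra s"
    and der: "derivation_on UNIV s (*) D" and D_nz: "D \<noteq> (\<lambda>_. 0)"
    and B_eq: "B = vector_type s D \<gamma>"
    and simple: "simple_superalgebra B"
    and alt: "alternative_superbimodule B V"
    and irr: "irreducible_superbimodule B V"
    and faith: "faithful_superbimodule B V"
    and p_add: "p (u + v) = p u + p v"
    and p_scl: "p (scl V c v) = scl V c (p v)"
    and p_total: "p v \<in> total V"
    and p_id: "v \<in> total V \<Longrightarrow> p v = v"
begin

abbreviation "M \<equiv> total V"

lemma D_add: "D (a + b) = D a + D b" and D_lin: "D (s c a) = s c (D a)"
  and D_mult: "D (a * b) = D a * b + a * D b"
  using der unfolding derivation_on_def linear_on_def by auto

lemma D0: "D 0 = 0" using D_add[of 0 0] by simp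
lemma superspace_V: "superspace V" and bilinear_action: "bilinear_on (total B) M (scl B) (scl V) (scl V) (lact V)"
  "bilinear_on M (total B) (scl V) (scl B) (scl V) (ract V)"
  and act_part: "a \<in> part B i \<Longrightarrow> v \<in> part V j \<Longrightarrow> lact V a v \<in> part V (i + j)"
  "a \<in> part B i \<Longrightarrow> v \<in> part V j \<Longrightarrow> ract V v a \<in> part V (j + i)"
  using alt unfolding alternative_superbimodule_def superbimodule_def by blast+

lemma vs: "vector_space (scl V)" and mod: "module (scl V)"
  using superspace_V by (simp_all add: superspace_def module_iff_vector_space)

lemma part_sub: "module.subspace (scl V) (part V i)"
  using superspace_V by (simp add: superspace_def)

lemma part_add: "u \<in> part V i \<Longrightarrow> v \<in> part V i \<Longrightarrow> u + v \<in> part V i"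
  and part_zero: "0 \<in> part V i" and part_neg: "v \<in> part V i \<Longrightarrow> - v \<in> part V i"
  and part_scl: "v \<in> part V i \<Longrightarrow> scl V c v \<in> part V i"
  using part_sub by (auto simp: module.subspace_def[OF mod] intro: module.subspace_neg[OF mod part_sub])

lemma part_total: "v \<in> part V i \<Longrightarrow> v \<in> M"
  using bit_cases[of i] part_zero[of 0] part_zero[of 1] unfolding total_def by force

lemma M_decomp: "v \<in> M \<Longrightarrow> \<exists>x\<in>part V 0. \<exists>y\<in>part V 1. v = x + y"
  unfolding total_def by blast

lemma M_add: "u \<in> M \<Longrightarrow> v \<in> M \<Longrightarrow> u + v \<in> M"
  and M_neg: "v \<in> M \<Longrightarrow> - v \<in> M" and M_zero: "0 \<in> M" and M_scl: "v \<in> M \<Longrightarrow> scl V c v \<in> M"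
  using subspace_total[OF superspace_V] by (auto simp: module.subspace_def[OF mod] intro: module.subspace_neg[OF mod])

lemma B_simps: "part B 0 = UNIV \<times> {0}" "part B 1 = {0} \<times> UNIV"
  "mul B (a, b) (a', b') = (a * a' + (\<gamma> * b * b' + 2 * D b * b' + b * D b'), a * b' + b * a')"
  "scl B c (a, b) = (s c a, s c b)"
  by (simp_all add: B_eq vector_type_def)

lemma total_B: "total B = UNIV"
proof -
  have "(a, b) \<in> total B" for a b
  proof -
    have "(a, b) = (a, 0) + (0, b)" "(a, 0) \<in> part B 0" "(0, b) \<in> part B 1" by (simp_all add: B_simps)
    then show ?thesis unfolding total_def by blast
  qed
  then show ?thesis by auto
qed

lemma act_add: "u \<in> M \<Longrightarrow> v \<in> M \<Longrightarrow> lact V a (u + v) = lact V a u + lact V a v"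
  "u \<in> M \<Longrightarrow> v \<in> M \<Longrightarrow> ract V (u + v) a = ract V u a + ract V v a"
  "v \<in> M \<Longrightarrow> lact V (a + b) v = lact V a v + lact V b v"
  "v \<in> M \<Longrightarrow> ract V v (a + b) = ract V v a + ract V v b"
  "v \<in> M \<Longrightarrow> lact V a (scl V c v) = scl V c (lact V a v)"
  "v \<in> M \<Longrightarrow> ract V (scl V c v) a = scl V c (ract V v a)"
  "v \<in> M \<Longrightarrow> lact V (scl B c a) v = scl V c (lact V a v)"
  using bilinear_action unfolding total_B bilinear_on_def linear_on_def by (simp_all del: split_paired_All)

lemma act_M: assumes "v \<in> M" shows "lact V a v \<in> M" "ract V v a \<in> M"
proof -
  obtain x y where v: "x \<in> part V 0" "y \<in> part V 1" "v = x + y" using M_decomp assms by metis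
  obtain a0 a1 where a: "a0 \<in> part B 0" "a1 \<in> part B 1" "a = a0 + a1"
    using total_B unfolding total_def by blast
  note m = v(1,2)[THEN part_total]
  have "lact V a v = (lact V a0 x + lact V a0 y) + (lact V a1 x + lact V a1 y)"
    unfolding v(3) a(3) by (simp add: act_add m M_add)
  moreover have "\<dots> \<in> M"
    using act_part(1)[OF a(1) v(1)] act_part(1)[OF a(1) v(2)] act_part(1)[OF a(2) v(1)] act_part(1)[OF a(2) v(2)]
    by (intro M_add) (auto intro: part_total)
  ultimately show "lact V a v \<in> M" by simp
  have "ract V v a = (ract V x a0 + ract V y a0) + (ract V x a1 + ract V y a1)"
    unfolding v(3) a(3) by (simp add: act_add m M_add)
  moreover have "\<dots> \<in> M"
    using act_part(2)[OF a(1) v(1)] act_part(2)[OF a(1) v(2)] act_part(2)[OF a(2) v(1)] act_part(2)[OF a(2) v(2)]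
    by (intro M_add) (auto intro: part_total)
  ultimately show "ract V v a \<in> M" by simp
qed

lemma act_zero: "lact V a 0 = 0" "ract V 0 a = 0" "v \<in> M \<Longrightarrow> lact V 0 v = 0" "v \<in> M \<Longrightarrow> ract V v 0 = 0"
  using act_add(1)[OF M_zero M_zero, of a] act_add(2)[OF M_zero M_zero, of a]
    act_add(3)[of v 0 0] act_add(4)[of v 0 0] by auto

lemma act_neg: "v \<in> M \<Longrightarrow> lact V a (- v) = - lact V a v" "v \<in> M \<Longrightarrow> ract V (- v) a = - ract V v a"
  using act_add(1)[of v "- v" a] act_add(2)[of v "- v" a] M_neg act_zero
  by (auto simp: eq_neg_iff_add_eq_0 add.commute)

definition par where "par v = component V 0 (p v) - component V 1 (p v)"

lemma par_sum: "x \<in> part V 0 \<Longrightarrow> y \<in> part V 1 \<Longrightarrow> par (x + y) = x - y"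
  using component_eq[OF superspace_V, of x y] part_total M_add by (simp add: par_def p_id)

lemma par_part: "v \<in> part V 0 \<Longrightarrow> par v = v" "v \<in> part V 1 \<Longrightarrow> par v = - v"
  using par_sum[of v 0] par_sum[of 0 v] part_zero by auto

lemma p_decomp: "\<exists>x\<in>part V 0. \<exists>y\<in>part V 1. p v = x + y"
  by (rule M_decomp[OF p_total])

lemma par_p: "par (p v) = par v"
  by (simp add: par_def p_id p_total)

lemma par_add: "par (u + v) = par u + par v"
proof -
  obtain x y x' y' where h: "x \<in> part V 0" "y \<in> part V 1" "x' \<in> part V 0" "y' \<in> part V 1"
    "p u = x + y" "p v = x' + y'" using p_decomp by metis
  have "p (u + v) = (x + x') + (y + y')" by (simp add: p_add h add_ac)
  then have "par (u + v) = (x + x') - (y + y')"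
    using par_p[of "u + v"] par_sum[of "x + x'" "y + y'"] h by (simp add: part_add)
  moreover have "par u = x - y" using par_sum[OF h(1,2)] par_p[of u] unfolding h(5) by simp
  moreover have "par v = x' - y'" using par_sum[OF h(3,4)] par_p[of v] unfolding h(6) by simp
  ultimately show ?thesis by (simp only:) (simp add: algebra_simps)
qed

lemma par_M: "par v \<in> M"
proof -
  obtain x y where h: "x \<in> part V 0" "y \<in> part V 1" "p v = x + y" using p_decomp by metis
  have "par v = x + - y" using par_p[of v] par_sum[of x y] h by simp
  then show ?thesis using h part_total part_neg M_add by metis
qed

text \<open>
  The associators \<open>(a, b, v)\<close>, \<open>(a, v, b)\<close> and \<open>(v, a, b)\<close> in the split null extension.
\<close>

definition left_assoc where "left_assoc a b v = lact V (mul B a b) v - lact V a (lact V b v)"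
definition middle_assoc where "middle_assoc a v b = ract V (lact V a v) b - lact V a (ract V v b)"
definition right_assoc where "right_assoc v a b = ract V (ract V v a) b - ract V v (mul B a b)"

lemma assoc_add: assumes "u \<in> M" "v \<in> M"
  shows "left_assoc a b (u + v) = left_assoc a b u + left_assoc a b v" "middle_assoc a (u + v) b = middle_assoc a u b + middle_assoc a v b"
   "right_assoc (u + v) a b = right_assoc u a b + right_assoc v a b"
  using assms by (simp_all add: left_assoc_def middle_assoc_def right_assoc_def act_add act_M)

lemma assoc_neg: assumes "v \<in> M"
  shows "middle_assoc a (- v) b = - middle_assoc a v b"
  using assms by (simp add: middle_assoc_def act_neg act_M)

text \<open>
  The super identities are given with signs for homogeneous vectors; an additive identity
  may be checked on the two parts.
\<close>

lemma eq_on_parts: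
  assumes "\<And>u v. u \<in> M \<Longrightarrow> v \<in> M \<Longrightarrow> f (u + v) = f u + f v"
    "\<And>u v. u \<in> M \<Longrightarrow> v \<in> M \<Longrightarrow> g (u + v) = g u + (g v :: 'v)"
    "\<And>v. v \<in> part V 0 \<Longrightarrow> f v = g v" "\<And>v. v \<in> part V 1 \<Longrightarrow> f v = g v"
    and "v \<in> M"
  shows "f v = g v"
proof -
  obtain x y where h: "x \<in> part V 0" "y \<in> part V 1" "v = x + y" using M_decomp assms(5) by metis
  then show ?thesis using assms(1,2)[of x y] assms(3)[of x] assms(4)[of y] part_total by metis
qed

lemma alt_hom:
  assumes a: "a \<in> part B i" and b: "b \<in> part B j" and v: "v \<in> part V k"
  shows "left_assoc a b v = scl V ((- 1) ^ (of_bit (j * k) + 1)) (middle_assoc a v b)"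
    "left_assoc a b v = scl V ((- 1) ^ (of_bit (i * j) + 1)) (left_assoc b a v)"
    "middle_assoc a v b = scl V ((- 1) ^ (of_bit (i * k) + 1)) (right_assoc v a b)"
    "right_assoc v a b = scl V ((- 1) ^ (of_bit (i * j) + 1)) (right_assoc v b a)"
proof -
  let ?E = "split_null_extension B V"
  have vM: "v \<in> M" by (rule part_total[OF v])
  have m0: "mul B x 0 = 0" "mul B 0 x = 0" for x
    by (cases x; simp add: B_eq vector_type_def zero_prod_def D0)+
  have as: "associator ?E x y z = scl ?E ((- 1) ^ (of_bit (j * k) + 1)) (associator ?E x z y)"
     "associator ?E x y z = scl ?E ((- 1) ^ (of_bit (i * j) + 1)) (associator ?E y x z)"
    if "x \<in> part ?E i" "y \<in> part ?E j" "z \<in> part ?E k" for x y z i j k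
    using alt that unfolding alternative_superbimodule_def alternative_superalgebra_def by blast+
  have pB: "0 \<in> part B i" for i by (simp add: B_eq vector_type_def zero_prod_def)
  have mem: "(a, 0) \<in> part ?E i" "(b, 0) \<in> part ?E j" "(0, v) \<in> part ?E k"
    using a b v part_zero pB by (auto simp: split_null_extension_def)
  have E1: "associator ?E (x, 0) (y, 0) (0, v) = (0, left_assoc x y v)" for x y
    by (simp add: associator_def split_null_extension_def left_assoc_def m0 act_zero act_M vM)
  have E2: "associator ?E (x, 0) (0, v) (y, 0) = (0, middle_assoc x v y)" for x y
    by (simp add: associator_def split_null_extension_def middle_assoc_def m0 act_zero act_M vM)
  have E3: "associator ?E (0, v) (x, 0) (y, 0) = (0, right_assoc v x y)" for x y
    by (simp add: associator_def split_null_extension_def right_assoc_def m0 act_zero act_M vM)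
  have sE: "snd (scl ?E c (x, w)) = scl V c w" for c x w
    by (simp add: split_null_extension_def)
  show "left_assoc a b v = scl V ((- 1) ^ (of_bit (j * k) + 1)) (middle_assoc a v b)"
    using arg_cong[OF as(1)[OF mem], of snd] unfolding E1 E2 E3 sE by simp
  show "left_assoc a b v = scl V ((- 1) ^ (of_bit (i * j) + 1)) (left_assoc b a v)"
    using arg_cong[OF as(2)[OF mem], of snd] unfolding E1 E2 E3 sE by simp
  show "middle_assoc a v b = scl V ((- 1) ^ (of_bit (i * k) + 1)) (right_assoc v a b)"
    using arg_cong[OF as(2)[OF mem(1,3,2)], of snd] unfolding E1 E2 E3 sE by simp
  show "right_assoc v a b = scl V ((- 1) ^ (of_bit (i * j) + 1)) (right_assoc v b a)"
    using arg_cong[OF as(1)[OF mem(3,1,2)], of snd] unfolding E1 E2 E3 sE by simp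
qed

lemma scl_sign: "scl V ((- 1) ^ (of_bit (0::bit) + 1)) x = - x" "scl V ((- 1) ^ (of_bit (1::bit) + 1)) x = x"
  by (simp_all add: module.scale_minus_left[OF mod] module.scale_one[OF mod])

abbreviation ev :: "'g \<Rightarrow> 'g \<times> 'g" where "ev a \<equiv> (a, 0)"

lemma ev_part: "ev a \<in> part B 0" and bar_part: "bar b \<in> part B 1"
  by (simp_all add: B_simps)

lemmas alt_ee = alt_hom[OF ev_part ev_part, unfolded mult_zero_left scl_sign]
lemmas alt_eo = alt_hom[OF ev_part bar_part, unfolded mult_zero_left mult_1_left mult_1_right scl_sign]
lemmas alt_oe = alt_hom[OF bar_part ev_part, unfolded mult_zero_left mult_1_left mult_zero_right scl_sign]
lemmas alt_oo = alt_hom[OF bar_part bar_part, unfolded mult_zero_left mult_1_left mult_1_right scl_sign]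

lemma alt_even_even: assumes "v \<in> M"
  shows "left_assoc (ev a) (ev b) v = - left_assoc (ev b) (ev a) v" "right_assoc v (ev a) (ev b) = - right_assoc v (ev b) (ev a)"
    "left_assoc (ev a) (ev b) v = - middle_assoc (ev a) v (ev b)" "middle_assoc (ev a) v (ev b) = - right_assoc v (ev a) (ev b)"
proof -
  show "left_assoc (ev a) (ev b) v = - left_assoc (ev b) (ev a) v"
    by (rule eq_on_parts[of "\<lambda>v. left_assoc (ev a) (ev b) v" "\<lambda>v. - left_assoc (ev b) (ev a) v", OF _ _ _ _ assms]; ((simp add: assoc_add; fail) | (rule alt_ee, assumption)))
  show "right_assoc v (ev a) (ev b) = - right_assoc v (ev b) (ev a)"
    by (rule eq_on_parts[of "\<lambda>v. right_assoc v (ev a) (ev b)" "\<lambda>v. - right_assoc v (ev b) (ev a)", OF _ _ _ _ assms]; ((simp add: assoc_add; fail) | (rule alt_ee, assumption)))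
  show "left_assoc (ev a) (ev b) v = - middle_assoc (ev a) v (ev b)"
    by (rule eq_on_parts[of "\<lambda>v. left_assoc (ev a) (ev b) v" "\<lambda>v. - middle_assoc (ev a) v (ev b)", OF _ _ _ _ assms]; ((simp add: assoc_add; fail) | (rule alt_ee, assumption)))
  show "middle_assoc (ev a) v (ev b) = - right_assoc v (ev a) (ev b)"
    by (rule eq_on_parts[of "\<lambda>v. middle_assoc (ev a) v (ev b)" "\<lambda>v. - right_assoc v (ev a) (ev b)", OF _ _ _ _ assms]; ((simp add: assoc_add; fail) | (rule alt_ee, assumption)))
qed

lemma alt_even_odd: assumes "v \<in> M"
  shows "left_assoc (ev a) (bar b) v = - left_assoc (bar b) (ev a) v" "right_assoc v (ev a) (bar b) = - right_assoc v (bar b) (ev a)"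
    "middle_assoc (ev a) v (bar b) = - right_assoc v (ev a) (bar b)" "middle_assoc (bar b) v (ev a) = - left_assoc (bar b) (ev a) v"
    "left_assoc (ev a) (bar b) v = - middle_assoc (ev a) (par v) (bar b)"
proof -
  show "left_assoc (ev a) (bar b) v = - left_assoc (bar b) (ev a) v"
    by (rule eq_on_parts[of "\<lambda>v. left_assoc (ev a) (bar b) v" "\<lambda>v. - left_assoc (bar b) (ev a) v", OF _ _ _ _ assms]; ((simp add: assoc_add; fail) | (rule alt_eo, assumption)))
  show "right_assoc v (ev a) (bar b) = - right_assoc v (bar b) (ev a)"
    by (rule eq_on_parts[of "\<lambda>v. right_assoc v (ev a) (bar b)" "\<lambda>v. - right_assoc v (bar b) (ev a)", OF _ _ _ _ assms]; ((simp add: assoc_add; fail) | (rule alt_eo, assumption)))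
  show "middle_assoc (ev a) v (bar b) = - right_assoc v (ev a) (bar b)"
    by (rule eq_on_parts[of "\<lambda>v. middle_assoc (ev a) v (bar b)" "\<lambda>v. - right_assoc v (ev a) (bar b)", OF _ _ _ _ assms]; ((simp add: assoc_add; fail) | (rule alt_eo, assumption)))
  have "left_assoc (bar b) (ev a) v = - middle_assoc (bar b) v (ev a)"
    by (rule eq_on_parts[of "\<lambda>v. left_assoc (bar b) (ev a) v" "\<lambda>v. - middle_assoc (bar b) v (ev a)", OF _ _ _ _ assms]; ((simp add: assoc_add; fail) | (rule alt_oe, assumption)))
  then show "middle_assoc (bar b) v (ev a) = - left_assoc (bar b) (ev a) v" by simp
  show "left_assoc (ev a) (bar b) v = - middle_assoc (ev a) (par v) (bar b)"
  proof (rule eq_on_parts[of "\<lambda>v. left_assoc (ev a) (bar b) v" "\<lambda>v. - middle_assoc (ev a) (par v) (bar b)", OF _ _ _ _ assms])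
    show "left_assoc (ev a) (bar b) v = - middle_assoc (ev a) (par v) (bar b)" if "v \<in> part V 0" for v
      using alt_eo(1)[OF that, of a b] by (simp add: par_part that scl_sign[simplified])
    show "left_assoc (ev a) (bar b) v = - middle_assoc (ev a) (par v) (bar b)" if "v \<in> part V 1" for v
      using alt_eo(1)[OF that, of a b] part_total[OF that]
      by (simp add: par_part that assoc_neg scl_sign[simplified])
  qed (simp_all add: assoc_add par_add par_M)
qed

lemma alt_odd_odd: assumes "v \<in> M"
  shows "right_assoc v (bar b) (bar c) = right_assoc v (bar c) (bar b)" "left_assoc (bar b) (bar c) v = left_assoc (bar c) (bar b) v"
    "right_assoc v (bar b) (bar c) = - middle_assoc (bar b) (par v) (bar c)" "middle_assoc (bar b) (par v) (bar c) = - left_assoc (bar b) (bar c) v"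
proof -
  show "right_assoc v (bar b) (bar c) = right_assoc v (bar c) (bar b)"
    by (rule eq_on_parts[of "\<lambda>v. right_assoc v (bar b) (bar c)" "\<lambda>v. right_assoc v (bar c) (bar b)", OF _ _ _ _ assms]; ((simp add: assoc_add; fail) | (rule alt_oo, assumption)))
  show "left_assoc (bar b) (bar c) v = left_assoc (bar c) (bar b) v"
    by (rule eq_on_parts[of "\<lambda>v. left_assoc (bar b) (bar c) v" "\<lambda>v. left_assoc (bar c) (bar b) v", OF _ _ _ _ assms]; ((simp add: assoc_add; fail) | (rule alt_oo, assumption)))
  show "right_assoc v (bar b) (bar c) = - middle_assoc (bar b) (par v) (bar c)"
  proof (rule eq_on_parts[of "\<lambda>v. right_assoc v (bar b) (bar c)" "\<lambda>v. - middle_assoc (bar b) (par v) (bar c)", OF _ _ _ _ assms])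
    show "right_assoc v (bar b) (bar c) = - middle_assoc (bar b) (par v) (bar c)" if "v \<in> part V 0" for v
      using alt_oo(3)[OF that, of b c] by (simp add: par_part that scl_sign[simplified])
    show "right_assoc v (bar b) (bar c) = - middle_assoc (bar b) (par v) (bar c)" if "v \<in> part V 1" for v
      using alt_oo(3)[OF that, of b c] part_total[OF that]
      by (simp add: par_part that assoc_neg scl_sign[simplified])
  qed (simp_all add: assoc_add par_add par_M)
  show "middle_assoc (bar b) (par v) (bar c) = - left_assoc (bar b) (bar c) v"
  proof (rule eq_on_parts[of "\<lambda>v. middle_assoc (bar b) (par v) (bar c)" "\<lambda>v. - left_assoc (bar b) (bar c) v", OF _ _ _ _ assms])
    show "middle_assoc (bar b) (par v) (bar c) = - left_assoc (bar b) (bar c) v" if "v \<in> part V 0" for v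
      using alt_oo(1)[OF that, of b c] by (simp add: par_part that scl_sign[simplified])
    show "middle_assoc (bar b) (par v) (bar c) = - left_assoc (bar b) (bar c) v" if "v \<in> part V 1" for v
      using alt_oo(1)[OF that, of b c] part_total[OF that]
      by (simp add: par_part that assoc_neg scl_sign[simplified])
  qed (simp_all add: assoc_add par_add par_M)
qed

definition opl where "opl a v = lact V (ev a) (p v)"
definition opr where "opr a v = ract V (p v) (ev a)"
definition opL where "opL b v = lact V (bar b) (p v)"
definition opR where "opR b v = ract V (p v) (bar b)"

lemmas op_defs = opl_def opr_def opL_def opR_def

lemma three: "v + v + v = (0::'v)"
proof -
  have "(1 + 1 + 1 :: 'f) = of_nat CHAR('f)" unfolding char by simp
  then have "scl V (1 + 1 + 1) v = 0"
    by (simp only: of_nat_CHAR module.scale_zero_left[OF mod])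
  then show ?thesis
    by (simp only: module.scale_left_distrib[OF mod] module.scale_one[OF mod])
qed

lemma par_act: assumes "v \<in> M"
  shows "par (lact V (ev a) v) = lact V (ev a) (par v)" "par (ract V v (ev a)) = ract V (par v) (ev a)"
    "par (lact V (bar a) v) = - lact V (bar a) (par v)" "par (ract V v (bar a)) = - ract V (par v) (bar a)"
proof -
  have e: "part V (0 + 0) = part V 0" "part V (0 + 1) = part V 1" "part V (1 + 0) = part V 1"
    "part V (1 + 1) = part V 0" by simp_all
  note act0 = act_part[OF ev_part] and act1 = act_part[OF bar_part]
  note h = act0[of _ 0, unfolded e] act0[of _ 1, unfolded e] act1[of _ 0, unfolded e] act1[of _ 1, unfolded e]
  show "par (lact V (ev a) v) = lact V (ev a) (par v)"
    by (rule eq_on_parts[of "\<lambda>v. par (lact V (ev a) v)" "\<lambda>v. lact V (ev a) (par v)", OF _ _ _ _ assms]) (auto simp: act_add par_add par_M par_part act_neg part_total h)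
  show "par (ract V v (ev a)) = ract V (par v) (ev a)"
    by (rule eq_on_parts[of "\<lambda>v. par (ract V v (ev a))" "\<lambda>v. ract V (par v) (ev a)", OF _ _ _ _ assms]) (auto simp: act_add par_add par_M par_part act_neg part_total h)
  show "par (lact V (bar a) v) = - lact V (bar a) (par v)"
    by (rule eq_on_parts[of "\<lambda>v. par (lact V (bar a) v)" "\<lambda>v. - lact V (bar a) (par v)", OF _ _ _ _ assms]) (auto simp: act_add par_add par_M par_part act_neg part_total h)
  show "par (ract V v (bar a)) = - ract V (par v) (bar a)"
    by (rule eq_on_parts[of "\<lambda>v. par (ract V v (bar a))" "\<lambda>v. - ract V (par v) (bar a)", OF _ _ _ _ assms]) (auto simp: act_add par_add par_M par_part act_neg part_total h)
qed

lemma par_par: "v \<in> M \<Longrightarrow> par (par v) = v"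
  by (rule eq_on_parts[of "\<lambda>v. par (par v)" "\<lambda>v. v"])
     (auto simp: par_add par_part part_neg)

lemma par_par_p: "par (par v) = p v"
  using par_par[OF p_total, of v] by (simp add: par_p)

lemma p_act [simp]: "p (lact V a (p v)) = lact V a (p v)" "p (ract V (p v) a) = ract V (p v) a"
  "p (par v) = par v" "par (p v) = par v" "p (lact V a (par v)) = lact V a (par v)"
  "p (ract V (par v) a) = ract V (par v) a"
  by (simp_all add: p_id act_M p_total par_M par_p)

lemma mul_simps: "mul B (ev a) (ev b) = ev (a * b)" "mul B (ev a) (bar b) = bar (a * b)"
  "mul B (bar b) (ev a) = bar (a * b)" "mul B (bar b) (bar c) = ev (\<gamma> * b * c + 2 * D b * c + b * D c)"
  by (simp_all add: B_simps mult.commute D0)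

lemmas assoc_defs = left_assoc_def middle_assoc_def right_assoc_def mul_simps

lemma s_mult: "s c a = s c 1 * a"
  using comm unfolding comm_algebra_def by (metis mult_1_left)

lemma s_zero: "s c 0 = 0"
  using comm by (simp add: comm_algebra_def module_iff_vector_space[symmetric] module.scale_zero_right)

text \<open>
  If \<open>I\<close> is an ideal of \<open>\<Gamma>\<close> stable under \<open>D\<close>, then \<open>I\<close> plus its odd copy is a graded ideal
  of \<open>B\<close>.
\<close>

lemma D_simple:
  assumes I: "0 \<in> I" "\<And>x y. x \<in> I \<Longrightarrow> y \<in> I \<Longrightarrow> x + y \<in> I" "\<And>a x. x \<in> I \<Longrightarrow> a * x \<in> I"
    "\<And>x. x \<in> I \<Longrightarrow> D x \<in> I"
  shows "I = {0} \<or> I = UNIV"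
proof -
  have B: "superspace B" using simple by (simp add: simple_superalgebra_def superalgebra_def)
  then have m: "module (scl B)" by (simp add: superspace_def module_iff_vector_space)
  have m1: "x * a \<in> I" if "x \<in> I" for a x using I(3)[OF that, of a] by (simp add: mult.commute)
  have sI: "s c x \<in> I" if "x \<in> I" for c x by (subst s_mult) (rule I(3)[OF that])
  have "graded_ideal B (I \<times> I)"
    unfolding graded_ideal_def graded_subspace_def
  proof (intro conjI ballI)
    show "module.subspace (scl B) (I \<times> I)"
      unfolding module.subspace_def[OF m]
      using I(1) by (auto simp: zero_prod_def B_simps intro: I(2) sI)
    show "I \<times> I = {x + y |x y. x \<in> I \<times> I \<inter> part B 0 \<and> y \<in> I \<times> I \<inter> part B 1}"
    proof (intro equalityI subsetI)
      fix z assume "z \<in> I \<times> I"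
      then have "z = (fst z, 0) + (0, snd z)" "(fst z, 0) \<in> I \<times> I \<inter> part B 0" "(0, snd z) \<in> I \<times> I \<inter> part B 1"
        using I(1) by (auto simp: B_simps)
      then show "z \<in> {x + y |x y. x \<in> I \<times> I \<inter> part B 0 \<and> y \<in> I \<times> I \<inter> part B 1}" by blast
    qed (auto intro: I(2))
    fix a x :: "'g \<times> 'g" assume x: "x \<in> I \<times> I"
    obtain b c y z where ax: "a = (b, c)" "x = (y, z)" by (metis surj_pair)
    have yz: "y \<in> I" "z \<in> I" using x ax by simp_all
    show "mul B a x \<in> I \<times> I"
      unfolding ax B_simps mem_Times_iff fst_conv snd_conv
      by (intro conjI I(2) I(3) I(4) yz)
    have "mul B x a = (b * y + (\<gamma> * c * z + 2 * c * D z + D c * z), c * y + b * z)"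
      unfolding ax B_simps by (simp add: mult_ac)
    also have "\<dots> \<in> I \<times> I"
      unfolding mem_Times_iff fst_conv snd_conv
      by (intro conjI I(2) I(3) I(4) yz)
    finally show "mul B x a \<in> I \<times> I" .
  qed
  then have "I \<times> I = {0} \<or> I \<times> I = UNIV"
    using simple total_B by (simp add: simple_superalgebra_def)
  then show ?thesis
  proof
    assume h: "I \<times> I = {0}"
    have "x = 0" if "x \<in> I" for x
    proof -
      have "(x, x) \<in> I \<times> I" using that by blast
      then show ?thesis unfolding h by (simp add: zero_prod_def)
    qed
    then show ?thesis using I(1) by blast
  next
    assume h: "I \<times> I = UNIV"
    have "x \<in> I" for x
    proof -
      have "(x, x) \<in> I \<times> I" unfolding h by simp
      then show ?thesis by blast
    qed
    then show ?thesis by blast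
  qed
qed

lemma action: "alternative_action D \<gamma> M opl opr opL opR par (scl V) (\<lambda>c. s c 1)"
proof
  show "\<exists>a. D a \<noteq> 0" using D_nz by auto
  show "\<exists>v\<in>M. v \<noteq> 0"
    using irr M_zero unfolding irreducible_superbimodule_def by auto
  show "u + v \<in> M" if "u \<in> M" "v \<in> M" for u v using that by (rule M_add)
  fix a b c :: 'g and v :: 'v
  note ee = alt_even_even[OF p_total[of v], unfolded assoc_defs] and eo = alt_even_odd[OF p_total[of v], unfolded assoc_defs p_act]
    and oo = alt_odd_odd[OF p_total[of v], unfolded assoc_defs p_act]
  show "opl (a * b) v - opl a (opl b v) = - (opl (a * b) v - opl b (opl a v))"
    using ee(1)[of a b] by (simp add: op_defs mult.commute)
  show "opr b (opr a v) - opr (a * b) v = - (opr a (opr b v) - opr (a * b) v)"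
    using ee(2)[of a b] by (simp add: op_defs mult.commute)
  show "opl (a * b) v - opl a (opl b v) = - (opr b (opl a v) - opl a (opr b v))"
    using ee(3)[of a b] by (simp add: op_defs mult.commute)
  show "opr b (opl a v) - opl a (opr b v) = - (opr b (opr a v) - opr (a * b) v)"
    using ee(4)[of a b] by (simp add: op_defs mult.commute)
  show "opL (a * b) v - opl a (opL b v) = - (opL (a * b) v - opL b (opl a v))"
    using eo(1)[of a b] by (simp add: op_defs)
  show "opR b (opr a v) - opR (a * b) v = - (opr a (opR b v) - opR (a * b) v)"
    using eo(2)[of a b] by (simp add: op_defs)
  show "opR b (opl a v) - opl a (opR b v) = - (opR b (opr a v) - opR (a * b) v)"
    using eo(3)[of a b] by (simp add: op_defs)
  show "opr a (opL b v) - opL b (opr a v) = - (opL (a * b) v - opL b (opl a v))"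
    using eo(4)[of b a] by (simp add: op_defs)
  show "opL (a * b) v - opl a (opL b v) = - (opR b (opl a (par v)) - opl a (opR b (par v)))"
    using eo(5)[of a b] by (simp add: op_defs)
  show "opR c (opR b v) - opr (\<gamma> * b * c + 2 * D b * c + b * D c) v =
     opR b (opR c v) - opr (\<gamma> * c * b + 2 * D c * b + c * D b) v"
    using oo(1)[of b c] by (simp add: op_defs)
  show "opl (\<gamma> * b * c + 2 * D b * c + b * D c) v - opL b (opL c v) =
     opl (\<gamma> * c * b + 2 * D c * b + c * D b) v - opL c (opL b v)"
    using oo(2)[of b c] by (simp add: op_defs)
  show "opR c (opR b v) - opr (\<gamma> * b * c + 2 * D b * c + b * D c) v =
     - (opR c (opL b (par v)) - opL b (opR c (par v)))"
    using oo(3)[of b c] by (simp add: op_defs)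
  show "opR c (opL b (par v)) - opL b (opR c (par v)) =
     - (opl (\<gamma> * b * c + 2 * D b * c + b * D c) v - opL b (opL c v))"
    using oo(4)[of b c] by (simp add: op_defs)
  fix k
  show "scl V k v \<in> M" if "v \<in> M" using that by (rule M_scl)
next
  fix I assume "0 \<in> I" "\<And>x y. x \<in> I \<Longrightarrow> y \<in> I \<Longrightarrow> x + y \<in> I" "\<And>a x. x \<in> I \<Longrightarrow> a * x \<in> I"
    "\<And>x. x \<in> I \<Longrightarrow> D x \<in> I"
  then show "I = {0} \<or> I = UNIV" by (rule D_simple)
next
  fix S assume S: "S \<subseteq> M" "0 \<in> S" "\<And>u v. u \<in> S \<Longrightarrow> v \<in> S \<Longrightarrow> u + v \<in> S"
    "\<And>a v. v \<in> S \<Longrightarrow> opl a v \<in> S" "\<And>a v. v \<in> S \<Longrightarrow> opr a v \<in> S"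
    "\<And>a v. v \<in> S \<Longrightarrow> opL a v \<in> S" "\<And>a v. v \<in> S \<Longrightarrow> opR a v \<in> S"
    "\<And>v. v \<in> S \<Longrightarrow> par v \<in> S" "\<And>k v. v \<in> S \<Longrightarrow> scl V k v \<in> S"
  have neg: "- v = v + v" for v :: 'v using three[of v] by (simp add: add_eq_0_iff add.assoc)
  have n: "- v \<in> S" if "v \<in> S" for v unfolding neg by (intro S(3) that)
  have "graded_subbimodule B V S"
    unfolding graded_subbimodule_def graded_subspace_def
  proof (intro conjI ballI)
    show "module.subspace (scl V) S"
      unfolding module.subspace_def[OF mod] by (auto intro: S(2,3,9))
    show "S = {x + y |x y. x \<in> S \<inter> part V 0 \<and> y \<in> S \<inter> part V 1}"
    proof (intro equalityI subsetI)
      fix v assume v: "v \<in> S"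
      obtain x y where h: "x \<in> part V 0" "y \<in> part V 1" "v = x + y" using M_decomp[OF subsetD[OF S(1) v]] by blast
      have p: "par v = x - y" unfolding h(3) by (rule par_sum[OF h(1,2)])
      \<comment> \<open>Again \<open>1/2 = -1\<close> recovers the homogeneous components from \<open>v\<close> and \<open>par v\<close>.\<close>
      have "v + par v = - x" unfolding p unfolding h(3) neg[of x] by simp
      then have "- (v + par v) = x" by simp
      moreover have "v + - par v = - y" unfolding p unfolding h(3) neg[of y] by simp
      then have "- (v + - par v) = y" by simp
      moreover have "- (v + par v) \<in> S" "- (v + - par v) \<in> S"
        by (intro n S(3) S(8) v)+
      ultimately show "v \<in> {x + y |x y. x \<in> S \<inter> part V 0 \<and> y \<in> S \<inter> part V 1}"
        using h by blast
    next
      fix v assume "v \<in> {x + y |x y. x \<in> S \<inter> part V 0 \<and> y \<in> S \<inter> part V 1}"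
      then obtain x y where "x \<in> S" "y \<in> S" "v = x + y" by blast
      then show "v \<in> S" by (simp add: S(3))
    qed
    fix a v assume v: "v \<in> S"
    have M: "v \<in> M" using v S(1) by blast
    obtain a0 a1 where a: "a = ev a0 + bar a1" by (cases a) auto
    have "lact V a v = opl a0 v + opL a1 v" unfolding a by (simp only: act_add[OF M] op_defs p_id[OF M])
    then show "lact V a v \<in> S" using S(3)[OF S(4) S(6), OF v v] by simp
    have "ract V v a = opr a0 v + opR a1 v" unfolding a by (simp only: act_add[OF M] op_defs p_id[OF M])
    then show "ract V v a \<in> S" using S(3)[OF S(5) S(7), OF v v] by simp
  qed
  then show "S = {0} \<or> S = M" using irr unfolding irreducible_superbimodule_def by blast
next
  fix a assume z: "\<And>v. opl a v = 0" "\<And>v. opr a v = 0"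
  have "\<forall>v\<in>M. lact V (ev a) v = 0 \<and> ract V v (ev a) = 0"
    using z p_id unfolding op_defs by metis
  then have "ev a \<in> {a \<in> total B. \<forall>v\<in>M. lact V a v = 0 \<and> ract V v a = 0}" using total_B by blast
  then have "ev a = 0" using faith unfolding faithful_superbimodule_def by blast
  then show "a = 0" by (simp add: zero_prod_def)
next
  fix a b :: 'g and v k
  show "opl (a + b) v = opl a v + opl b v" "opr (a + b) v = opr a v + opr b v"
    "opL (a + b) v = opL a v + opL b v" "opR (a + b) v = opR a v + opR b v"
    using act_add(3,4)[OF p_total[of v], of "ev a" "ev b"] act_add(3,4)[OF p_total[of v], of "bar a" "bar b"]
    by (simp_all add: op_defs)
  show "scl V k (opl a v) = opl (s k 1 * a) v"
    using act_add(7)[OF p_total[of v], of k "ev a"] s_mult[of k a] s_zero by (simp add: op_defs B_simps)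
  show "opl a (scl V k v) = scl V k (opl a v)" "opr a (scl V k v) = scl V k (opr a v)"
    by (simp_all add: op_defs p_scl act_add p_total)
qed (simp_all add: D_add D_mult three op_defs act_M p_total par_M p_add act_add par_add par_act par_par par_par_p p_id
   module.scale_zero_right[OF mod] M_scl)

section \<open>The structure theorem\<close>

interpretation alternative_action D \<gamma> M opl opr opL opR par "scl V" "\<lambda>c. s c 1"
  by (rule action)

lemma superspace_B: "superspace B"
  using simple by (simp add: simple_superalgebra_def superalgebra_def)

lemma component_B: "component B 0 (a, b) = ev a" "component B 1 (a, b) = bar b"
  using component_eq[OF superspace_B ev_part bar_part, of a b] by simp_all

lemma Hom_part: "Hom False = part V 0" "Hom True = part V 1"
proof -
  have "v \<in> part V 0" if v: "v \<in> M" "par v = v" for v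
  proof -
    obtain x y where h: "x \<in> part V 0" "y \<in> part V 1" "v = x + y" using M_decomp[OF v(1)] by blast
    have "x - y = x + y" using par_sum[OF h(1,2)] v(2) h(3) by simp
    then have "y + y = 0 + 0" by (simp add: algebra_simps)
    then have "y = 0" by (rule double_eq)
    then show ?thesis using h by simp
  qed
  moreover have "v \<in> part V 1" if v: "v \<in> M" "par v = - v" for v
  proof -
    obtain x y where h: "x \<in> part V 0" "y \<in> part V 1" "v = x + y" using M_decomp[OF v(1)] by blast
    have "x - y = - (x + y)" using par_sum[OF h(1,2)] v(2) h(3) by simp
    then have "x = - x" by (simp add: algebra_simps)
    then have "x + x = 0 + 0" by (metis add.right_inverse add_0_left)
    then have "x = 0" by (rule double_eq)
    then show ?thesis using h by simp
  qed
  ultimately show "Hom False = part V 0" "Hom True = part V 1"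
    by (auto simp: Hom_def sg_def part_total par_part)
qed

lemma bimodule_structure:
  "\<exists>U \<in> {V, change_parity B V}.
    let W = part_bimodule U 0; d = (\<lambda>v. - right_associator B U v (bar 1) (bar 1)) in
      D_bimodule s D W d \<and> D_simple_bimodule W d \<and> faithful_bimodule W \<and> assoc_comm_bimodule W \<and>
      part U 1 = (\<lambda>v. ract U v (bar 1)) ` part U 0 \<and>
      bimodule_iso W (part_bimodule U 1) (\<lambda>v. ract U v (bar 1)) \<and>
      isomorphic_superbimodules B U (vector_type_bimodule D \<gamma> W d)"
proof -
  obtain i where i: "\<forall>v\<in>Hom i. \<forall>a. T a v = 0" "Hom (\<not> i) = X ` Hom i"
    using Hom_cases by blast
  define U where "U = (if i then change_parity B V else V)"
  interpret standard_bimodule D \<gamma> M opl opr opL opR par "scl V" "\<lambda>c. s c 1" i s U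
  proof (intro standard_bimodule.intro standard_part.intro action standard_bimodule_axioms.intro standard_part_axioms.intro)
    show "T a v = 0" if "v \<in> Hom i" for a v using i that by blast
    show "Hom (\<not> i) = X ` Hom i" by (rule i)
    show "comm_algebra s" by (rule comm)
    show "D (s c a) = s c (D a)" for c a by (rule D_lin)
    have scl: "scl U = scl V" by (simp add: U_def change_parity_def)
    show "vector_space (scl U)" unfolding scl by (rule vs)
    show "scl U c v = opl (s c 1) v" if "v \<in> M" for c v
      using sc_em[of c 1 v] unital_left[OF that] by (simp add: scl)
    show "part U 0 = Hom i" "part U 1 = Hom (\<not> i)"
      by (cases i; simp add: U_def change_parity_def Hom_part)+
    show "lact U (a, b) v = opl a v + sg i (opL b v)" if "v \<in> M" for a b v
    proof (cases i)
      case True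
      then show ?thesis by (simp add: U_def change_parity_def component_B op_defs p_id that sg_def)
    next
      case False
      then show ?thesis using act_add(3)[OF that, of "ev a" "bar b"]
        by (simp add: U_def op_defs p_id that sg_def)
    qed
    show "ract U v (a, b) = opl a v + opR b v" if "v \<in> M" for a b v
      using act_add(4)[OF that, of "ev a" "bar b"] r_eq[of a v]
      by (simp add: U_def change_parity_def op_defs p_id that)
  qed
  have "U \<in> {V, change_parity B V}" by (simp add: U_def)
  then show ?thesis
    unfolding Let_def using conclusion unfolding B_eq[symmetric] by blast
qed

end

lemma subspace_projection:
  assumes "vector_space s" "module.subspace s S"
  shows "\<exists>p. (\<forall>u v. p (u + v) = p u + p v) \<and> (\<forall>c v. p (s c v) = s c (p v)) \<and>
    (\<forall>v. p v \<in> S) \<and> (\<forall>v\<in>S. p v = v)"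
proof -
  interpret vector_space_pair s s using assms(1) by (simp add: vector_space_pair_def)
  have "Vector_Spaces.linear s s (\<lambda>v. v)" by (rule vs1.linear_ident)
  then obtain g where g: "g ` UNIV \<subseteq> S" "Vector_Spaces.linear s s g" "\<forall>v\<in>S. g v = v"
    using linear_exists_left_inverse_on[of "\<lambda>v. v" S] assms(2) by auto
  then show ?thesis
    by (intro exI[of _ g]) (auto simp: linear_add linear_scale)
qed

theorem theorem6p2:
  fixes s :: "'f::field \<Rightarrow> 'g::comm_ring_1 \<Rightarrow> 'g"
    and D :: "'g \<Rightarrow> 'g" and \<gamma> :: 'g
    and B :: "('f, 'g \<times> 'g) salgebra"
    and V :: "('f, 'g \<times> 'g, 'v::ab_group_add) sbimodule"
  assumes "CHAR('f) = 3"
    and "comm_algebra s"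
    and "derivation_on UNIV s (*) D" and "D \<noteq> (\<lambda>_. 0)"
    and "B = vector_type s D \<gamma>"
    and "simple_superalgebra B"
    and "alternative_superbimodule B V"
    and "irreducible_superbimodule B V"
    and "faithful_superbimodule B V"
    and "\<not> associative_superbimodule B V"
  shows "\<exists>U \<in> {V, change_parity B V}.
    let W = part_bimodule U 0; d = (\<lambda>v. - right_associator B U v (bar 1) (bar 1)) in
      D_bimodule s D W d \<and> D_simple_bimodule W d \<and> faithful_bimodule W \<and> assoc_comm_bimodule W \<and>
      part U 1 = (\<lambda>v. ract U v (bar 1)) ` part U 0 \<and>
      bimodule_iso W (part_bimodule U 1) (\<lambda>v. ract U v (bar 1)) \<and>
      isomorphic_superbimodules B U (vector_type_bimodule D \<gamma> W d)"
proof -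
  have V: "superspace V"
    using assms(7) by (simp add: alternative_superbimodule_def superbimodule_def)
  then have vs: "vector_space (scl V)" by (simp add: superspace_def)
  obtain p where "\<forall>u v. p (u + v) = p u + p v" "\<forall>c v. p (scl V c v) = scl V c (p v)"
    "\<forall>v. p v \<in> total V" "\<forall>v\<in>total V. p v = v"
    using subspace_projection[OF vs subspace_total[OF V]] by blast
  then interpret faithful_irreducible_bimodule s D \<gamma> V B p
    using assms by unfold_locales auto
  show ?thesis by (rule bimodule_structure)
qed

end
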